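(* Let $J\in L^2(\Omega)^3$ and let $\alpha^0,\alpha^1\in\mathbb{R}$ be arbitrary non-zero stabilization parameters. Then the system: find $p_h\in V^0_h$, $B_h\in V^1_h$ and $z_h\in\mathcal{H}^1_h$ such that $$\left\{\begin{aligned} &\alpha^0\langle(I-P^0_h)q,(I-P^0_h)p_h\rangle+\langle\operatorname{grad}P^0_hq,B_h\rangle=0\\ &\langle v,\operatorname{grad}P^0_hp_h\rangle+\langle\operatorname{curl}P^1_hv,\operatorname{curl}P^1_hB_h\rangle+\alpha^1\langle(I-P^1_h)v,(I-P^1_h)B_h\rangle+\langle v,z_h\rangle=\langle\operatorname{curl}P^1_hv,J\rangle\\ &\langle w,B_h\rangle=0 \end{aligned}\right.$$ for all $q\in V^0_h$, $v\in V^1_h$, $w\in\mathcal{H}^1_h$ (or equivalently, in operator form: find $p_h\in V^0_h$, $B_h\in V^1_h\cap(\mathcal{H}^1_h)^\perp$ and $z_h\in\mathcal{H}^1_h$ such that $\alpha^0S^0_hp_h-\widetilde{\operatorname{div}}_hB_h=0$ and $\operatorname{grad}_hp_h+\widetilde{\operatorname{curl}}_h\operatorname{curl}_hB_h+\alpha^1S^1_hB_h+z_h=\widetilde{\operatorname{curl}}_h\tilde\Pi^2_hJ$) is well-posed, and its solution satisfies $$B_h\in V^{1,c}_h\cap\big(\mathcal{H}^1_h\oplus\operatorname{grad}V^{0,c}_h\big)^\perp,\qquad p_h\in V^{0,c}_h\cap\ker\operatorname{grad}=\{0\},\qquad z_h=0.$$ Moreover, the discrete magnetic field can be decomposed as $$B_h=B^{\rm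 g}_h+B^{\rm h}_h+B^{\rm c}_h\in\operatorname{grad}^c_hV^{0,c}_h\overset{\perp}{\oplus}\mathcal{H}^1_h\overset{\perp}{\oplus}\widetilde{\operatorname{curl}}^c_hV^{2,c}_h$$ with discrete grad, harmonic and curl components characterized by $$B^{\rm g}_h=0,\qquad B^{\rm h}_h=0,\qquad\langle w,\operatorname{curl}B^{\rm c}_h\rangle=\langle w,J\rangle\quad\forall\,w\in\operatorname{curl}V^{1,c}_h.$$ In particular, the solution is independent of the non-zero stabilization parameters and of the conforming projection operators.
   Context: $\langle\cdot,\cdot\rangle$ is the $L^2(\Omega)$ scalar product, $\perp$ refers to $L^2$-orthogonality, $\overset{\perp}{\oplus}$ is an $L^2$-orthogonal direct sum, and $A^*$ is the $L^2$-adjoint of a linear operator $A$ between the finite-dimensional spaces below. Let $\Omega\subset\mathbb{R}^3$ be a domain decomposed in a partition of open subdomains $\Omega_k$, $k=1,\dots,K$, and set $V^0=H^1_0(\Omega)$, $V^1=H_0(\operatorname{curl};\Omega)$, $V^2=H_0(\operatorname{div};\Omega)$. For each $k$ let $V^0_h(\Omega_k)\subset H^1(\Omega_k)$, $V^1_h(\Omega_k)\subset H(\operatorname{curl};\Omega_k)$, $V^2_h(\Omega_k)\subset H(\operatorname{div};\Omega_k)$ be finite-dimensional spaces (no boundary conditions) with $\operatorname{grad}V^0_h(\Omega_k)\subset V^1_h(\Omega_k)$ and $\operatorname{curl}V^1_h(\Omega_k)\subset V^2_h(\Omega_k)$. The broken spaces are $$V^\ell_h:=\{v\in L^2(\Omega):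 v|_{\Omega_k}\in V^\ell_h(\Omega_k),\ k=1,\dots,K\}$$ (vector-valued for $\ell=1,2$), and the conforming spaces are $V^{\ell,c}_h:=V^\ell_h\cap V^\ell$; one has $\operatorname{grad}V^{0,c}_h\subset V^{1,c}_h$, $\operatorname{curl}V^{1,c}_h\subset V^{2,c}_h$. For $\ell=0,1,2$ the conforming projection $P^\ell_h:V^\ell_h\to V^\ell_h$ is a linear projection with range $V^{\ell,c}_h$. Operators: - $\operatorname{grad}_h:=\operatorname{grad}P^0_h:V^0_h\to V^1_h$, $\operatorname{curl}_h:=\operatorname{curl}P^1_h:V^1_h\to V^2_h$. - $\widetilde{\operatorname{div}}_h:=(-\operatorname{grad}_h)^*:V^1_h\to V^0_h$, $\widetilde{\operatorname{curl}}_h:=(\operatorname{curl}_h)^*:V^2_h\to V^1_h$ ($L^2$-adjoints). - $\operatorname{grad}^c_h:=\operatorname{grad}|_{V^{0,c}_h}$, $\operatorname{curl}^c_h:=\operatorname{curl}|_{V^{1,c}_h}:V^{1,c}_h\to V^{2,c}_h$, and $\widetilde{\operatorname{curl}}^c_h:=(\operatorname{curl}^c_h)^*:V^{2,c}_h\to V^{1,c}_h$. - $S^\ell_h:=(I-P^\ell_h)^*(I-P^\ell_h)$. - $\tilde\Pi^2_h:L^2(\Omega)^3\to V^2_h$ is defined by $\langle\tilde\Pi^2_hJ,w\rangle=\langle J,P^2_hw\rangle$ for all $w\in V^2_h$. Discrete harmonic 1-forms: $\mathcal{H}^1_h:=\{v\in V^{1,c}_h:\operatorname{curl}v=0\text{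 and }\langle\operatorname{grad}q,v\rangle=0\ \forall q\in V^{0,c}_h\}$. The discrete Hodge–Helmholtz decomposition reads $V^{1,c}_h=\operatorname{grad}^c_hV^{0,c}_h\overset{\perp}{\oplus}\mathcal{H}^1_h\overset{\perp}{\oplus}\widetilde{\operatorname{curl}}^c_hV^{2,c}_h$. "Well-posed" means existence and uniqueness of the solution for every $J$. *)

theory Defs
  imports "HOL-Analysis.Analysis"
begin

section \<open>Square-integrable functions modulo almost-everywhere equality\<close>

text \<open>
  The type \<open>'b L2\<close> is $L^2(\mathbb{R}^3)$ with values in \<open>'b\<close>. Borel representatives suffice,
  since every Lebesgue measurable function agrees almost everywhere with a Borel one.
  The space $L^2(\Omega)$ is represented inside \<open>'b L2\<close> through extension by zero
  (\<open>L2_on\<close> below), so that the scalar product of $L^2(\Omega)$ is \<open>inner\<close>.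
\<close>

definition square_integrable :: "(real^3 \<Rightarrow> 'b::euclidean_space) \<Rightarrow> bool" where
  "square_integrable f \<longleftrightarrow>
     f \<in> borel_measurable lborel \<and> integrable lborel (\<lambda>x. (norm (f x))\<^sup>2)"

definition L2_eq :: "(real^3 \<Rightarrow> 'b::euclidean_space) \<Rightarrow> (real^3 \<Rightarrow> 'b) \<Rightarrow> bool" where
  "L2_eq f g \<longleftrightarrow> square_integrable f \<and> square_integrable g \<and> (AE x in lborel. f x = g x)"

lemma square_integrable_zero: "square_integrable (\<lambda>_. 0)"
  by (simp add: square_integrable_def)

lemma square_integrable_scaleR:
  "square_integrable f \<Longrightarrow> square_integrable (\<lambda>x. c *\<^sub>R f x)"
  by (auto simp: square_integrable_def power_mult_distrib)

lemma square_integrable_add: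
  assumes f: "square_integrable f" and g: "square_integrable g"
  shows "square_integrable (\<lambda>x. f x + g x)"
proof -
  have [measurable]: "f \<in> borel_measurable lborel" "g \<in> borel_measurable lborel"
    using f g by (auto simp: square_integrable_def)
  have "integrable lborel (\<lambda>x. 2 * (norm (f x))\<^sup>2 + 2 * (norm (g x))\<^sup>2)"
    using f g by (auto simp: square_integrable_def)
  then have "integrable lborel (\<lambda>x. (norm (f x + g x))\<^sup>2)"
  proof (rule Bochner_Integration.integrable_bound)
    show "AE x in lborel. norm ((norm (f x + g x))\<^sup>2)
            \<le> norm (2 * (norm (f x))\<^sup>2 + 2 * (norm (g x))\<^sup>2)"
    proof (intro AE_I2)
      fix x
      have "(norm (f x + g x))\<^sup>2 \<le> (norm (f x) + norm (g x))\<^sup>2"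
        by (simp add: norm_triangle_ineq power_mono)
      also have "\<dots> \<le> 2 * (norm (f x))\<^sup>2 + 2 * (norm (g x))\<^sup>2"
        using sum_squares_bound[of "norm (f x)" "norm (g x)"] by (simp add: power2_sum)
      finally show "norm ((norm (f x + g x))\<^sup>2)
            \<le> norm (2 * (norm (f x))\<^sup>2 + 2 * (norm (g x))\<^sup>2)"
        by simp
    qed
  qed simp
  then show ?thesis by (simp add: square_integrable_def)
qed

lemma integrable_inner_square_integrable:
  assumes f: "square_integrable f" and g: "square_integrable g"
  shows "integrable lborel (\<lambda>x. f x \<bullet> g x)"
proof -
  have [measurable]: "f \<in> borel_measurable lborel" "g \<in> borel_measurable lborel"
    using f g by (auto simp: square_integrable_def)
  have "integrable lborel (\<lambda>x. (norm (f x))\<^sup>2 + (norm (g x))\<^sup>2)"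
    using f g by (auto simp: square_integrable_def)
  then show ?thesis
  proof (rule Bochner_Integration.integrable_bound)
    show "AE x in lborel. norm (f x \<bullet> g x) \<le> norm ((norm (f x))\<^sup>2 + (norm (g x))\<^sup>2)"
    proof (intro AE_I2)
      fix x
      have "\<bar>f x \<bullet> g x\<bar> \<le> norm (f x) * norm (g x)" by (rule Cauchy_Schwarz_ineq2)
      also have "\<dots> \<le> (norm (f x))\<^sup>2 + (norm (g x))\<^sup>2"
        using sum_squares_bound[of "norm (f x)" "norm (g x)"]
          mult_nonneg_nonneg[OF norm_ge_zero[of "f x"] norm_ge_zero[of "g x"]]
        by linarith
      finally show "norm (f x \<bullet> g x) \<le> norm ((norm (f x))\<^sup>2 + (norm (g x))\<^sup>2)"
        by simp
    qed
  qed simp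
qed

quotient_type (overloaded) 'b L2 = "real^3 \<Rightarrow> 'b::euclidean_space" / partial: L2_eq
proof (rule part_equivpI)
  show "\<exists>f::real^3 \<Rightarrow> 'b. L2_eq f f"
    using square_integrable_zero by (auto simp: L2_eq_def)
  show "symp (L2_eq :: (real^3 \<Rightarrow> 'b) \<Rightarrow> _)"
    by (rule sympI) (auto simp: L2_eq_def elim: eventually_mono)
  show "transp (L2_eq :: (real^3 \<Rightarrow> 'b) \<Rightarrow> _)"
  proof (rule transpI)
    fix f g h :: "real^3 \<Rightarrow> 'b"
    assume "L2_eq f g" "L2_eq g h"
    then show "L2_eq f h" by (auto simp: L2_eq_def elim: eventually_elim2)
  qed
qed

instantiation L2 :: (euclidean_space) real_inner
begin

lift_definition zero_L2 :: "'a L2" is "\<lambda>_. 0"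
  by (simp add: L2_eq_def square_integrable_zero)

lift_definition plus_L2 :: "'a L2 \<Rightarrow> 'a L2 \<Rightarrow> 'a L2" is "\<lambda>f g x. f x + g x"
  by (auto simp: L2_eq_def square_integrable_add elim: eventually_elim2)

lift_definition scaleR_L2 :: "real \<Rightarrow> 'a L2 \<Rightarrow> 'a L2" is "\<lambda>c f x. c *\<^sub>R f x"
  by (auto simp: L2_eq_def square_integrable_scaleR elim: eventually_mono)

definition uminus_L2 :: "'a L2 \<Rightarrow> 'a L2" where
  "uminus_L2 f = (-1) *\<^sub>R f"

definition minus_L2 :: "'a L2 \<Rightarrow> 'a L2 \<Rightarrow> 'a L2" where
  "minus_L2 f g = f + (-1) *\<^sub>R g"

lift_definition inner_L2 :: "'a L2 \<Rightarrow> 'a L2 \<Rightarrow> real" is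
  "\<lambda>f g. integral\<^sup>L lborel (\<lambda>x. f x \<bullet> g x)"
proof -
  fix f f' g g' :: "real^3 \<Rightarrow> 'a"
  assume fg: "L2_eq f f'" "L2_eq g g'"
  then have [measurable]: "f \<in> borel_measurable lborel" "f' \<in> borel_measurable lborel"
    "g \<in> borel_measurable lborel" "g' \<in> borel_measurable lborel"
    by (auto simp: L2_eq_def square_integrable_def)
  have "AE x in lborel. f x = f' x" "AE x in lborel. g x = g' x"
    using fg by (auto simp: L2_eq_def)
  then have "AE x in lborel. f x \<bullet> g x = f' x \<bullet> g' x"
    by eventually_elim simp
  then show "integral\<^sup>L lborel (\<lambda>x. f x \<bullet> g x) = integral\<^sup>L lborel (\<lambda>x. f' x \<bullet> g' x)"
    by (intro integral_cong_AE) simp_all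
qed

definition norm_L2 :: "'a L2 \<Rightarrow> real" where
  "norm_L2 f = sqrt (inner f f)"

definition dist_L2 :: "'a L2 \<Rightarrow> 'a L2 \<Rightarrow> real" where
  "dist_L2 f g = norm (f - g)"

definition sgn_L2 :: "'a L2 \<Rightarrow> 'a L2" where
  "sgn_L2 f = inverse (norm f) *\<^sub>R f"

definition uniformity_L2 :: "('a L2 \<times> 'a L2) filter" where
  "uniformity_L2 = (INF e\<in>{0<..}. principal {(x, y). dist x y < e})"

definition open_L2 :: "'a L2 set \<Rightarrow> bool" where
  "open_L2 U \<longleftrightarrow> (\<forall>x\<in>U. eventually (\<lambda>(x', y). x' = x \<longrightarrow> y \<in> U) uniformity)"

instance
proof
  fix a b c :: "'a L2" and r s :: real
  show add_assoc: "a + b + c = a + (b + c)"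
    by transfer (auto simp: L2_eq_def square_integrable_add add.assoc)
  show "a + b = b + a"
    by transfer (auto simp: L2_eq_def square_integrable_add add.commute)
  show "0 + a = a"
    by transfer (auto simp: L2_eq_def square_integrable_add)
  show "- a + a = 0"
    unfolding uminus_L2_def
    by transfer (auto simp: L2_eq_def square_integrable_zero
        intro!: square_integrable_add square_integrable_scaleR
        dest: square_integrable_scaleR[where c = "-1"] square_integrable_add)
  show "a - b = a + - b"
    by (simp add: minus_L2_def uminus_L2_def)
  show "r *\<^sub>R (a + b) = r *\<^sub>R a + r *\<^sub>R b"
    by transfer (auto simp: L2_eq_def scaleR_add_right
        intro!: square_integrable_add square_integrable_scaleR)
  show "(r + s) *\<^sub>R a = r *\<^sub>R a + s *\<^sub>R a"
    by transfer (auto simp: L2_eq_def scaleR_add_left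
        intro!: square_integrable_add square_integrable_scaleR)
  show "r *\<^sub>R s *\<^sub>R a = (r * s) *\<^sub>R a"
    by transfer (auto simp: L2_eq_def intro!: square_integrable_scaleR)
  show "1 *\<^sub>R a = a"
    by transfer (auto simp: L2_eq_def)
  show "dist a b = norm (a - b)" by (rule dist_L2_def)
  show "sgn a = inverse (norm a) *\<^sub>R a" by (rule sgn_L2_def)
  show "uniformity = (INF e\<in>{0<..}. principal {(x :: 'a L2, y). dist x y < e})"
    by (rule uniformity_L2_def)
  show "open U \<longleftrightarrow> (\<forall>x\<in>U. \<forall>\<^sub>F (x', y) in uniformity. x' = x \<longrightarrow> y \<in> U)" for U :: "'a L2 set"
    by (rule open_L2_def)
  show "inner a b = inner b a"
    by transfer (simp add: inner_commute)
  show "inner (a + b) c = inner a c + inner b c"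
    by transfer (simp add: L2_eq_def inner_add_left integrable_inner_square_integrable)
  show "inner (r *\<^sub>R a) b = r * inner a b"
    by transfer simp
  show "0 \<le> inner a a"
    by transfer (simp add: integral_nonneg_AE)
  show "inner a a = 0 \<longleftrightarrow> a = 0"
  proof transfer
    fix f :: "real^3 \<Rightarrow> 'a"
    assume "L2_eq f f"
    then have f: "square_integrable f" by (simp add: L2_eq_def)
    have "integral\<^sup>L lborel (\<lambda>x. f x \<bullet> f x) = 0 \<longleftrightarrow> (AE x in lborel. f x \<bullet> f x = 0)"
      by (rule integral_nonneg_eq_0_iff_AE)
        (use integrable_inner_square_integrable[OF f f] in auto)
    then show "integral\<^sup>L lborel (\<lambda>x. f x \<bullet> f x) = 0 \<longleftrightarrow> L2_eq f (\<lambda>_. 0)"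
      using f by (simp add: L2_eq_def square_integrable_zero)
  qed
  show "norm a = sqrt (inner a a)" by (rule norm_L2_def)
qed

end

definition restrict_L2 :: "(real^3) set \<Rightarrow> ('b::euclidean_space) L2 \<Rightarrow> 'b L2" where
  "restrict_L2 S u = abs_L2 (\<lambda>x. indicator S x *\<^sub>R rep_L2 u x)"

definition L2_on :: "(real^3) set \<Rightarrow> ('b::euclidean_space) L2 set" where
  "L2_on S = {u. AE x in lborel. x \<notin> S \<longrightarrow> rep_L2 u x = 0}"


section \<open>Test functions and classical differential operators\<close>

definition partial :: "3 \<Rightarrow> (real^3 \<Rightarrow> 'b::real_normed_vector) \<Rightarrow> real^3 \<Rightarrow> 'b" where
  "partial i f x = frechet_derivative f (at x) (axis i 1)"

primrec C_k :: "nat \<Rightarrow> (real^3 \<Rightarrow> 'b::real_normed_vector) \<Rightarrow> bool" where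
  "C_k 0 f \<longleftrightarrow> continuous_on UNIV f"
| "C_k (Suc n) f \<longleftrightarrow> (\<forall>x. f differentiable at x) \<and> (\<forall>i. C_k n (partial i f))"

definition test_functions :: "(real^3) set \<Rightarrow> (real^3 \<Rightarrow> 'b::real_normed_vector) set" where
  "test_functions \<Omega> =
     {\<phi>. (\<forall>n. C_k n \<phi>) \<and> compact (closure {x. \<phi> x \<noteq> 0}) \<and> closure {x. \<phi> x \<noteq> 0} \<subseteq> \<Omega>}"

definition classical_grad :: "(real^3 \<Rightarrow> real) \<Rightarrow> real^3 \<Rightarrow> real^3" where
  "classical_grad f x = (\<chi> i. partial i f x)"

definition classical_div :: "(real^3 \<Rightarrow> real^3) \<Rightarrow> real^3 \<Rightarrow> real" where
  "classical_div F x = (\<Sum>i\<in>UNIV. partial i F x $ i)"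

definition classical_curl :: "(real^3 \<Rightarrow> real^3) \<Rightarrow> real^3 \<Rightarrow> real^3" where
  "classical_curl F x = vector
     [partial 2 F x $ 3 - partial 3 F x $ 2,
      partial 3 F x $ 1 - partial 1 F x $ 3,
      partial 1 F x $ 2 - partial 2 F x $ 1]"


section \<open>Weak differential operators and their domains\<close>

definition has_weak_grad :: "(real^3) set \<Rightarrow> real L2 \<Rightarrow> (real^3) L2 \<Rightarrow> bool" where
  "has_weak_grad \<Omega> u g \<longleftrightarrow> u \<in> L2_on \<Omega> \<and> g \<in> L2_on \<Omega> \<and>
     (\<forall>\<phi>\<in>test_functions \<Omega>. inner g (abs_L2 \<phi>) = - inner u (abs_L2 (classical_div \<phi>)))"

definition has_weak_curl :: "(real^3) set \<Rightarrow> (real^3) L2 \<Rightarrow> (real^3) L2 \<Rightarrow> bool" where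
  "has_weak_curl \<Omega> u g \<longleftrightarrow> u \<in> L2_on \<Omega> \<and> g \<in> L2_on \<Omega> \<and>
     (\<forall>\<phi>\<in>test_functions \<Omega>. inner g (abs_L2 \<phi>) = inner u (abs_L2 (classical_curl \<phi>)))"

definition has_weak_div :: "(real^3) set \<Rightarrow> (real^3) L2 \<Rightarrow> real L2 \<Rightarrow> bool" where
  "has_weak_div \<Omega> u g \<longleftrightarrow> u \<in> L2_on \<Omega> \<and> g \<in> L2_on \<Omega> \<and>
     (\<forall>\<phi>\<in>test_functions \<Omega>. inner g (abs_L2 \<phi>) = - inner u (abs_L2 (classical_grad \<phi>)))"

text \<open>The weak derivative of \<open>u\<close> is unique when it exists, by density of the test functions in
  $L^2(\Omega)$; outside \<open>H1 \<Omega>\<close>, \<open>Hcurl \<Omega>\<close>, \<open>Hdiv \<Omega>\<close> the values below are unspecified.\<close>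

definition grad :: "(real^3) set \<Rightarrow> real L2 \<Rightarrow> (real^3) L2" where
  "grad \<Omega> u = (THE g. has_weak_grad \<Omega> u g)"

definition curl :: "(real^3) set \<Rightarrow> (real^3) L2 \<Rightarrow> (real^3) L2" where
  "curl \<Omega> u = (THE g. has_weak_curl \<Omega> u g)"

definition divergence :: "(real^3) set \<Rightarrow> (real^3) L2 \<Rightarrow> real L2" where
  "divergence \<Omega> u = (THE g. has_weak_div \<Omega> u g)"

definition H1 :: "(real^3) set \<Rightarrow> real L2 set" where
  "H1 \<Omega> = {u. \<exists>g. has_weak_grad \<Omega> u g}"

definition Hcurl :: "(real^3) set \<Rightarrow> (real^3) L2 set" where
  "Hcurl \<Omega> = {u. \<exists>g. has_weak_curl \<Omega> u g}"

definition Hdiv :: "(real^3) set \<Rightarrow> (real^3) L2 set" where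
  "Hdiv \<Omega> = {u. \<exists>g. has_weak_div \<Omega> u g}"

text \<open>The spaces with homogeneous boundary conditions are the closures of the test functions
  in the respective graph norms.\<close>

definition H1_0 :: "(real^3) set \<Rightarrow> real L2 set" where
  "H1_0 \<Omega> = {u \<in> H1 \<Omega>. \<exists>\<phi>. (\<forall>n. \<phi> n \<in> abs_L2 ` test_functions \<Omega>) \<and>
     \<phi> \<longlonglongrightarrow> u \<and> (\<lambda>n. grad \<Omega> (\<phi> n)) \<longlonglongrightarrow> grad \<Omega> u}"

definition Hcurl_0 :: "(real^3) set \<Rightarrow> (real^3) L2 set" where
  "Hcurl_0 \<Omega> = {u \<in> Hcurl \<Omega>. \<exists>\<phi>. (\<forall>n. \<phi> n \<in> abs_L2 ` test_functions \<Omega>) \<and>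
     \<phi> \<longlonglongrightarrow> u \<and> (\<lambda>n. curl \<Omega> (\<phi> n)) \<longlonglongrightarrow> curl \<Omega> u}"

definition Hdiv_0 :: "(real^3) set \<Rightarrow> (real^3) L2 set" where
  "Hdiv_0 \<Omega> = {u \<in> Hdiv \<Omega>. \<exists>\<phi>. (\<forall>n. \<phi> n \<in> abs_L2 ` test_functions \<Omega>) \<and>
     \<phi> \<longlonglongrightarrow> u \<and> (\<lambda>n. divergence \<Omega> (\<phi> n)) \<longlonglongrightarrow> divergence \<Omega> u}"


section \<open>Broken finite element spaces\<close>

definition domain :: "(real^3) set \<Rightarrow> bool" where
  "domain \<Omega> \<longleftrightarrow> open \<Omega> \<and> connected \<Omega> \<and> \<Omega> \<noteq> {}"

text \<open>The interfaces \<open>\<Omega> - (\<Union>k. \<Omega>s k)\<close> have measure zero; otherwise the restrictions to the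
  subdomains would not determine a function in $L^2(\Omega)$. For open \<open>\<Omega>\<close> this implies that
  \<open>\<Omega>\<close> is contained in the closure of the union of the subdomains.\<close>

definition domain_partition :: "(real^3) set \<Rightarrow> nat \<Rightarrow> (nat \<Rightarrow> (real^3) set) \<Rightarrow> bool" where
  "domain_partition \<Omega> K \<Omega>s \<longleftrightarrow>
     (\<forall>k\<in>{1..K}. domain (\<Omega>s k) \<and> \<Omega>s k \<subseteq> \<Omega>) \<and>
     disjoint_family_on \<Omega>s {1..K} \<and>
     negligible (\<Omega> - (\<Union>k\<in>{1..K}. \<Omega>s k))"

definition finite_dim_subspace :: "'v::real_vector set \<Rightarrow> bool" where
  "finite_dim_subspace V \<longleftrightarrow> (\<exists>B. finite B \<and> V = span B)"

definition local_spaces ::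
  "(real^3) set \<Rightarrow> real L2 set \<Rightarrow> (real^3) L2 set \<Rightarrow> (real^3) L2 set \<Rightarrow> bool" where
  "local_spaces \<Omega> V0 V1 V2 \<longleftrightarrow>
     finite_dim_subspace V0 \<and> finite_dim_subspace V1 \<and> finite_dim_subspace V2 \<and>
     V0 \<subseteq> H1 \<Omega> \<and> V1 \<subseteq> Hcurl \<Omega> \<and> V2 \<subseteq> Hdiv \<Omega> \<and>
     grad \<Omega> ` V0 \<subseteq> V1 \<and> curl \<Omega> ` V1 \<subseteq> V2"

definition broken_space ::
  "(real^3) set \<Rightarrow> nat \<Rightarrow> (nat \<Rightarrow> (real^3) set) \<Rightarrow> (nat \<Rightarrow> ('b::euclidean_space) L2 set) \<Rightarrow> 'b L2 set"
  where
  "broken_space \<Omega> K \<Omega>s V = {v \<in> L2_on \<Omega>. \<forall>k\<in>{1..K}. restrict_L2 (\<Omega>s k) v \<in> V k}"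

text \<open>Operators on a broken space \<open>V\<close> are total functions of which only the values on \<open>V\<close> matter.\<close>

definition linear_projection :: "'v::real_vector set \<Rightarrow> 'v set \<Rightarrow> ('v \<Rightarrow> 'v) \<Rightarrow> bool" where
  "linear_projection V W P \<longleftrightarrow>
     (\<forall>x\<in>V. \<forall>y\<in>V. P (x + y) = P x + P y) \<and> (\<forall>c. \<forall>x\<in>V. P (c *\<^sub>R x) = c *\<^sub>R P x) \<and>
     P ` V = W \<and> W \<subseteq> V \<and> (\<forall>x\<in>V. P (P x) = P x)"

definition adjoint_on :: "'v::real_inner set \<Rightarrow> ('v \<Rightarrow> 'w::real_inner) \<Rightarrow> 'w \<Rightarrow> 'v" where
  "adjoint_on V A w = (THE u. u \<in> V \<and> (\<forall>v\<in>V. inner v u = inner (A v) w))"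

definition stabilization :: "'v::real_inner set \<Rightarrow> ('v \<Rightarrow> 'v) \<Rightarrow> 'v \<Rightarrow> 'v" where
  "stabilization V P u = adjoint_on V (\<lambda>v. v - P v) (u - P u)"

definition dual_projection :: "'v::real_inner set \<Rightarrow> ('v \<Rightarrow> 'v) \<Rightarrow> 'v \<Rightarrow> 'v" where
  "dual_projection V P J = (THE u. u \<in> V \<and> (\<forall>w\<in>V. inner u w = inner J (P w)))"

definition harmonic_forms ::
  "(real^3) set \<Rightarrow> real L2 set \<Rightarrow> (real^3) L2 set \<Rightarrow> (real^3) L2 set" where
  "harmonic_forms \<Omega> V0c V1c =
     {v \<in> V1c. curl \<Omega> v = 0 \<and> (\<forall>q\<in>V0c. inner (grad \<Omega> q) v = 0)}"


section \<open>The discrete magnetostatic problem\<close>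

definition variational_solution ::
  "(real^3) set \<Rightarrow> real L2 set \<Rightarrow> (real^3) L2 set \<Rightarrow> (real^3) L2 set \<Rightarrow>
   (real L2 \<Rightarrow> real L2) \<Rightarrow> ((real^3) L2 \<Rightarrow> (real^3) L2) \<Rightarrow> real \<Rightarrow> real \<Rightarrow> (real^3) L2 \<Rightarrow>
   real L2 \<Rightarrow> (real^3) L2 \<Rightarrow> (real^3) L2 \<Rightarrow> bool" where
  "variational_solution \<Omega> V0h V1h H P0 P1 \<alpha>0 \<alpha>1 J p B z \<longleftrightarrow>
     p \<in> V0h \<and> B \<in> V1h \<and> z \<in> H \<and>
     (\<forall>q\<in>V0h. \<alpha>0 * inner (q - P0 q) (p - P0 p) + inner (grad \<Omega> (P0 q)) B = 0) \<and>
     (\<forall>v\<in>V1h.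
        inner v (grad \<Omega> (P0 p)) + inner (curl \<Omega> (P1 v)) (curl \<Omega> (P1 B))
        + \<alpha>1 * inner (v - P1 v) (B - P1 B) + inner v z = inner (curl \<Omega> (P1 v)) J) \<and>
     (\<forall>w\<in>H. inner w B = 0)"

definition operator_solution ::
  "(real^3) set \<Rightarrow> real L2 set \<Rightarrow> (real^3) L2 set \<Rightarrow> (real^3) L2 set \<Rightarrow> (real^3) L2 set \<Rightarrow>
   (real L2 \<Rightarrow> real L2) \<Rightarrow> ((real^3) L2 \<Rightarrow> (real^3) L2) \<Rightarrow> ((real^3) L2 \<Rightarrow> (real^3) L2) \<Rightarrow>
   real \<Rightarrow> real \<Rightarrow> (real^3) L2 \<Rightarrow> real L2 \<Rightarrow> (real^3) L2 \<Rightarrow> (real^3) L2 \<Rightarrow> bool" where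
  "operator_solution \<Omega> V0h V1h V2h H P0 P1 P2 \<alpha>0 \<alpha>1 J p B z \<longleftrightarrow>
     (let grad_h = (\<lambda>q. grad \<Omega> (P0 q));
          curl_h = (\<lambda>v. curl \<Omega> (P1 v));
          div_t = adjoint_on V0h (\<lambda>q. - grad_h q);
          curl_t = adjoint_on V1h curl_h
      in p \<in> V0h \<and> B \<in> V1h \<inter> H\<^sup>\<bottom> \<and> z \<in> H \<and>
         \<alpha>0 *\<^sub>R stabilization V0h P0 p - div_t B = 0 \<and>
         grad_h p + curl_t (curl_h B) + \<alpha>1 *\<^sub>R stabilization V1h P1 B + z
           = curl_t (dual_projection V2h P2 J))"

end

theory Submission
  imports Defs
begin

text \<open>
  Testing the first equation with $(I - P^0_h) p_h$ and the second one successively with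
  $\operatorname{grad} p_h$, $z_h$ and $(I - P^1_h) B_h$ shows that every solution has $p_h = 0$,
  $z_h = 0$ and $B_h \in V^{1,c}_h$, so that all stabilization terms vanish. What remains is the
  normal equation for the projection of $J$ onto $\operatorname{curl} V^{1,c}_h$, whose solution is
  unique in the orthogonal complement of the kernel of the curl.

  The analytic input is that weak derivatives are unique, that the weak derivatives of test functions
  form a complex, and that $\operatorname{grad}$ is injective on $H^1_0(\Omega)$ for an arbitrary open
  set.
\<close>

section \<open>Linear algebra in finite-dimensional subspaces\<close>

text \<open>The parameters may have any sign, so the stabilized form can be indefinite and
  coercivity is no guide. The tests work because a projection fixes conforming arguments and
  annihilates the range of $I - P$: each of them isolates a single squared norm. The reduced problem
  \<open>solves\<close> contains neither projections nor parameters, which is the source of the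
  independence claim.

  Operators are total functions with meaningful values only on a subspace, so linearity is stated
  relative to that subspace. Riesz representatives, projections and adjoints are all built in
  finite-dimensional subspaces of an inner product space.

  The set \<open>\<Omega>\<close> may be unbounded, where the usual Poincare inequality can fail.
  The weight $1/(1+x_1^2)$ is positive everywhere and has a bounded primitive, which is enough for
  injectivity.\<close>

definition linear_on_subspace :: "'v::real_vector set \<Rightarrow> ('v \<Rightarrow> 'w::real_vector) \<Rightarrow> bool" where
  "linear_on_subspace V f \<longleftrightarrow>
     (\<forall>x\<in>V. \<forall>y\<in>V. f (x + y) = f x + f y) \<and> (\<forall>c. \<forall>x\<in>V. f (c *\<^sub>R x) = c *\<^sub>R f x)"

lemma linear_on_subspaceD:
  assumes "linear_on_subspace V f"
  shows "x \<in> V \<Longrightarrow> y \<in> V \<Longrightarrow> f (x + y) = f x + f y"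
    and "x \<in> V \<Longrightarrow> f (c *\<^sub>R x) = c *\<^sub>R f x"
  using assms by (auto simp: linear_on_subspace_def)

lemma linear_on_subspace_mono:
  "linear_on_subspace V f \<Longrightarrow> U \<subseteq> V \<Longrightarrow> linear_on_subspace U f"
  unfolding linear_on_subspace_def by (meson subsetD)

lemma linear_on_subspace_0:
  assumes "linear_on_subspace V f" "0 \<in> V" shows "f 0 = 0"
  using linear_on_subspaceD(2)[OF assms, of 0] by simp

lemma linear_on_subspace_diff:
  assumes "linear_on_subspace V f" "subspace V" "x \<in> V" "y \<in> V"
  shows "f (x - y) = f x - f y"
proof -
  have "f (x + (-1) *\<^sub>R y) = f x + (-1) *\<^sub>R f y"
    using assms by (metis linear_on_subspaceD subspace_scale)
  then show ?thesis by simp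
qed

lemma subspace_image_linear_on:
  assumes f: "linear_on_subspace V f" and V: "subspace V"
  shows "subspace (f ` V)"
proof (rule subspaceI)
  show "0 \<in> f ` V"
    using linear_on_subspace_0[OF f] V by (metis imageI subspace_0)
  show "x + y \<in> f ` V" if "x \<in> f ` V" "y \<in> f ` V" for x y
    using that V
    by (auto simp: linear_on_subspaceD(1)[OF f, symmetric] intro!: imageI simp: subspace_add)
  show "c *\<^sub>R x \<in> f ` V" if "x \<in> f ` V" for c x
    using that V
    by (auto simp: linear_on_subspaceD(2)[OF f, symmetric] intro!: imageI simp: subspace_scale)
qed

lemma finite_dim_subspace_imp_subspace: "finite_dim_subspace V \<Longrightarrow> subspace V"
  by (auto simp: finite_dim_subspace_def)

text \<open>A maximal independent subset of \<open>U\<close> lies in the span of a finite set, so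
  the exchange bound makes it finite.\<close>

lemma finite_dim_subspace_subset:
  assumes V: "finite_dim_subspace V" and U: "subspace U" "U \<subseteq> V"
  shows "finite_dim_subspace U"
proof -
  obtain B where B: "finite B" "V = span B"
    using V by (auto simp: finite_dim_subspace_def)
  obtain C where C: "C \<subseteq> U" "independent C" "U \<subseteq> span C"
    using maximal_independent_subset[of U] by blast
  have "C \<subseteq> span B" using C(1) U(2) B(2) by blast
  then have "finite C" using independent_span_bound[OF B(1) C(2)] by blast
  moreover have "U = span C" using C U(1) by (metis span_minimal subset_antisym)
  ultimately show ?thesis by (auto simp: finite_dim_subspace_def)
qed

lemma linear_on_span_image:
  assumes f: "linear_on_subspace (span B) f" and x: "x \<in> span B"
  shows "f x \<in> span (f ` B)"
proof -
  \<comment> \<open>The membership of \<open>x\<close> is carried through the induction because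
    \<open>f\<close> is additive only on \<open>span B\<close>.\<close>
  have "x \<in> span B \<and> f x \<in> span (f ` B)"
    using x
  proof (induction rule: span_induct_alt)
    case base
    show ?case using linear_on_subspace_0[OF f span_zero] by (simp add: span_zero)
  next
    case (step c b y)
    then have "f (c *\<^sub>R b + y) = c *\<^sub>R f b + f y"
      using linear_on_subspaceD[OF f] by (simp add: span_base span_scale)
    then show ?case using step by (simp add: span_add span_base span_scale)
  qed
  then show ?thesis ..
qed

lemma finite_dim_subspace_image:
  assumes V: "finite_dim_subspace V" and f: "linear_on_subspace V f"
  shows "finite_dim_subspace (f ` V)"
proof -
  obtain B where B: "finite B" "V = span B"
    using V by (auto simp: finite_dim_subspace_def)
  have sub: "subspace (f ` V)"
    using subspace_image_linear_on[OF f] V by (simp add: finite_dim_subspace_imp_subspace)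
  have "f ` V = span (f ` B)"
  proof
    show "f ` V \<subseteq> span (f ` B)" using linear_on_span_image f B(2) by blast
    show "span (f ` B) \<subseteq> f ` V"
      using sub B(2) by (intro span_minimal) (auto intro: span_base)
  qed
  then show ?thesis using B(1) by (auto simp: finite_dim_subspace_def)
qed

text \<open>Gram-Schmidt, one generator at a time. The induction hypothesis is used for two
  functionals: for \<open>f\<close>, and for the product with the new generator \<open>b\<close>,
  whose representative \<open>e\<close> is the orthogonal projection of \<open>b\<close> onto
  \<open>span B\<close>.\<close>

lemma Riesz_finite_dim:
  fixes f :: "'v::real_inner \<Rightarrow> real"
  assumes V: "finite_dim_subspace V" and f: "linear_on_subspace V f"
  shows "\<exists>u\<in>V. \<forall>v\<in>V. inner v u = f v"
proof -
  have main: "linear_on_subspace (span B) f \<Longrightarrow> \<exists>u\<in>span B. \<forall>v\<in>span B. inner v u = f v"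
    if "finite B" for B :: "'v set" and f
    using that
  proof (induction B arbitrary: f rule: finite_induct)
    case empty
    then show ?case by (auto simp: linear_on_subspace_0)
  next
    case (insert b B)
    have lin: "linear_on_subspace (span B) g" if "linear_on_subspace (span (insert b B)) g"
      for g :: "'v \<Rightarrow> real"
      using that by (rule linear_on_subspace_mono) (simp add: span_mono subset_insertI)
    obtain e where e: "e \<in> span B" "\<And>v. v \<in> span B \<Longrightarrow> inner v e = inner v b"
      using insert.IH[of "\<lambda>v. inner v b"]
      by (auto simp: linear_on_subspace_def inner_add_left)
    define c where "c = b - e"
    have c: "inner v c = 0" if "v \<in> span B" for v
      using e(2)[OF that] by (simp add: c_def inner_diff_right)
    obtain u where u: "u \<in> span B" "\<And>v. v \<in> span B \<Longrightarrow> inner v u = f v"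
      using insert.IH[OF lin[OF insert.prems]] by blast
    have sub: "span B \<subseteq> span (insert b B)" by (simp add: span_mono subset_insertI)
    have c_in: "c \<in> span (insert b B)"
      unfolding c_def using e(1) sub by (blast intro: span_diff span_base)
    \<comment> \<open>Since \<open>u\<close> is orthogonal to \<open>c\<close>, this coefficient
      gives \<open>inner c w = f c\<close>. For \<open>c = 0\<close> the quotient is zero by
      convention, and \<open>f c\<close> is zero as well.\<close>
    define w where "w = u + (f c / inner c c) *\<^sub>R c"
    have w_in: "w \<in> span (insert b B)"
      unfolding w_def using u(1) sub c_in by (blast intro: span_add span_scale)
    have fc: "f c = 0" if "c = 0"
      using that linear_on_subspace_0[OF insert.prems span_zero] by simp
    have "inner v w = f v" if v: "v \<in> span (insert b B)" for v
    proof -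
      obtain k where k: "v - k *\<^sub>R b \<in> span B" using v by (auto simp: span_insert)
      \<comment> \<open>Splitting \<open>b = e + c\<close> moves the multiple of \<open>e\<close>
        into \<open>span B\<close> and leaves a multiple of the orthogonal vector
        \<open>c\<close>.\<close>
      define y where "y = v - k *\<^sub>R b + k *\<^sub>R e"
      have y: "y \<in> span B" unfolding y_def using k e(1) by (intro span_add span_scale)
      have v_eq: "v = y + k *\<^sub>R c" by (simp add: y_def c_def algebra_simps)
      have "f v = f y + k * f c"
        unfolding v_eq using insert.prems y sub c_in
        by (subst linear_on_subspaceD(1)[OF insert.prems])
          (auto simp: linear_on_subspaceD(2)[OF insert.prems] intro: span_scale)
      moreover have "inner v w = inner y u + k * f c"
        using c[OF y] c[OF u(1)] fc unfolding v_eq w_def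
        by (cases "c = 0") (simp_all add: inner_add_left inner_add_right inner_commute)
      ultimately show ?thesis using u(2)[OF y] by simp
    qed
    then show ?case using w_in by blast
  qed
  show ?thesis using V main f by (auto simp: finite_dim_subspace_def)
qed

lemma inner_eq_on_subspace_imp_eq:
  fixes u u' :: "'v::real_inner"
  assumes "subspace V" "u \<in> V" "u' \<in> V" "\<And>v. v \<in> V \<Longrightarrow> inner v u = inner v u'"
  shows "u = u'"
proof -
  have "inner (u - u') (u - u') = 0"
    using assms(4)[of "u - u'"] assms(1-3) by (simp add: subspace_diff inner_diff_right)
  then show ?thesis by simp
qed

lemma orthogonal_projection_exists:
  fixes x :: "'v::real_inner"
  assumes V: "finite_dim_subspace V"
  obtains y where "y \<in> V" "\<And>v. v \<in> V \<Longrightarrow> inner v (x - y) = 0"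
proof -
  have "linear_on_subspace V (\<lambda>v. inner v x)"
    by (auto simp: linear_on_subspace_def inner_add_left)
  from Riesz_finite_dim[OF V this] show ?thesis
    using that by (auto simp: inner_diff_right)
qed

text \<open>\<open>adjoint_on\<close> is a definite description: its value is meaningful only once
  existence, from the Riesz representation, and uniqueness, from testing a difference with itself,
  are known.\<close>

lemma adjoint_on_properties:
  fixes A :: "'v::real_inner \<Rightarrow> 'w::real_inner"
  assumes V: "finite_dim_subspace V" and A: "linear_on_subspace V A"
  shows "adjoint_on V A w \<in> V"
    and "v \<in> V \<Longrightarrow> inner v (adjoint_on V A w) = inner (A v) w"
proof -
  have "linear_on_subspace V (\<lambda>v. inner (A v) w)"
    using A by (auto simp: linear_on_subspace_def inner_add_left)
  from Riesz_finite_dim[OF V this]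
  have "\<exists>!u. u \<in> V \<and> (\<forall>v\<in>V. inner v u = inner (A v) w)"
    using inner_eq_on_subspace_imp_eq[OF finite_dim_subspace_imp_subspace[OF V]] by metis
  from theI'[OF this] show "adjoint_on V A w \<in> V"
    and "v \<in> V \<Longrightarrow> inner v (adjoint_on V A w) = inner (A v) w"
    by (auto simp: adjoint_on_def)
qed

lemma adjoint_on_eqI:
  fixes A :: "'v::real_inner \<Rightarrow> 'w::real_inner"
  assumes V: "finite_dim_subspace V" and A: "linear_on_subspace V A"
    and "u \<in> V" "\<And>v. v \<in> V \<Longrightarrow> inner v u = inner (A v) w"
  shows "adjoint_on V A w = u"
  using assms adjoint_on_properties[OF V A] finite_dim_subspace_imp_subspace[OF V]
  by (intro inner_eq_on_subspace_imp_eq[of V]) auto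

text \<open>With the factors of the inner product exchanged, the defining condition is that of the
  adjoint of \<open>P\<close> applied to \<open>J\<close>.\<close>

lemma dual_projection_properties:
  fixes P :: "'v::real_inner \<Rightarrow> 'v"
  assumes V: "finite_dim_subspace V" and P: "linear_on_subspace V P"
  shows "dual_projection V P J \<in> V"
    and "w \<in> V \<Longrightarrow> inner (dual_projection V P J) w = inner J (P w)"
proof -
  have "dual_projection V P J = adjoint_on V P J"
    by (simp add: dual_projection_def adjoint_on_def inner_commute)
  then show "dual_projection V P J \<in> V"
    and "w \<in> V \<Longrightarrow> inner (dual_projection V P J) w = inner J (P w)"
    using adjoint_on_properties[OF V P] by (simp_all add: inner_commute)
qed

lemma linear_projectionD:
  assumes "linear_projection V W P"
  shows "linear_on_subspace V P" "P ` V = W" "W \<subseteq> V" "x \<in> V \<Longrightarrow> P x \<in> W" "x \<in> W \<Longrightarrow> P x = x"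
  using assms by (auto simp: linear_projection_def linear_on_subspace_def)

text \<open>As images of the broken spaces under linear projections, the conforming spaces inherit
  finite dimension and with it the subspace property.\<close>

lemma finite_dim_subspace_range_projection:
  "finite_dim_subspace V \<Longrightarrow> linear_projection V W P \<Longrightarrow> finite_dim_subspace W"
  using finite_dim_subspace_image linear_projectionD(1,2) by metis

section \<open>Test functions and their density\<close>

lemma L2_eq_rep: "L2_eq (rep_L2 u) (rep_L2 u)"
  using Quotient3_rep_reflp[OF Quotient3_L2] .

lemma abs_rep_L2: "abs_L2 (rep_L2 u) = u"
  using Quotient3_abs_rep[OF Quotient3_L2] .

lemma square_integrable_rep: "square_integrable (rep_L2 u)"
  using L2_eq_rep[of u] by (simp add: L2_eq_def)

lemma rep_L2_measurable [measurable]: "rep_L2 u \<in> borel_measurable lborel"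
  using square_integrable_rep by (auto simp: square_integrable_def)

lemma rep_abs_L2_AE:
  assumes "square_integrable f"
  shows "AE x in lborel. rep_L2 (abs_L2 f) x = f x"
proof -
  have "L2_eq (rep_L2 (abs_L2 f)) f"
    using assms by (intro Quotient3_rep_abs[OF Quotient3_L2]) (simp add: L2_eq_def)
  then show ?thesis by (simp add: L2_eq_def)
qed

lemma L2_eqI:
  assumes "AE x in lborel. rep_L2 u x = rep_L2 v x"
  shows "u = v"
proof -
  have "L2_eq (rep_L2 u) (rep_L2 v)"
    using assms square_integrable_rep by (auto simp: L2_eq_def)
  then show ?thesis
    using Quotient3_rel_rep[OF Quotient3_L2] by blast
qed

lemma abs_L2_add:
  "square_integrable f \<Longrightarrow> square_integrable g \<Longrightarrow> abs_L2 f + abs_L2 g = abs_L2 (\<lambda>x. f x + g x)"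
  by (simp add: plus_L2.abs_eq L2_eq_def)

lemma abs_L2_scaleR:
  "square_integrable f \<Longrightarrow> c *\<^sub>R abs_L2 f = abs_L2 (\<lambda>x. c *\<^sub>R f x)"
  by (simp add: scaleR_L2.abs_eq L2_eq_def)

lemma rep_L2_add_AE: "AE x in lborel. rep_L2 (u + v) x = rep_L2 u x + rep_L2 v x"
  using rep_abs_L2_AE[OF square_integrable_add[OF square_integrable_rep[of u] square_integrable_rep[of v]]]
  by (simp add: abs_L2_add[symmetric] square_integrable_rep abs_rep_L2)

lemma rep_L2_scaleR_AE: "AE x in lborel. rep_L2 (c *\<^sub>R u) x = c *\<^sub>R rep_L2 u x"
  using rep_abs_L2_AE[OF square_integrable_scaleR[OF square_integrable_rep[of u], of c]]
  by (simp add: abs_L2_scaleR[symmetric] square_integrable_rep abs_rep_L2)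

lemma rep_L2_zero_AE: "AE x in lborel. rep_L2 0 x = 0"
  using rep_abs_L2_AE[OF square_integrable_zero] by (simp add: zero_L2_def)

lemma inner_abs_L2:
  "square_integrable f \<Longrightarrow> square_integrable g \<Longrightarrow>
    inner (abs_L2 f) (abs_L2 g) = integral\<^sup>L lborel (\<lambda>x. f x \<bullet> g x)"
  by (simp add: inner_L2.abs_eq L2_eq_def)

lemma inner_L2_rep: "inner u v = integral\<^sup>L lborel (\<lambda>x. rep_L2 u x \<bullet> rep_L2 v x)"
  using inner_abs_L2[OF square_integrable_rep square_integrable_rep, of u v] by (simp add: abs_rep_L2)

lemma inner_L2_abs:
  "square_integrable f \<Longrightarrow> inner u (abs_L2 f) = integral\<^sup>L lborel (\<lambda>x. rep_L2 u x \<bullet> f x)"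
  using inner_abs_L2[OF square_integrable_rep, of f u] by (simp add: abs_rep_L2)

lemma L2_on_zero: "0 \<in> L2_on S"
  using rep_L2_zero_AE by (auto simp: L2_on_def elim: eventually_mono)

lemma L2_on_add: "u \<in> L2_on S \<Longrightarrow> v \<in> L2_on S \<Longrightarrow> u + v \<in> L2_on S"
  unfolding L2_on_def mem_Collect_eq
  using rep_L2_add_AE[of u v] by (auto elim!: eventually_rev_mp)

lemma L2_on_scaleR: "u \<in> L2_on S \<Longrightarrow> c *\<^sub>R u \<in> L2_on S"
  unfolding L2_on_def mem_Collect_eq
  using rep_L2_scaleR_AE[of c u] by (auto elim!: eventually_rev_mp)

lemma subspace_L2_on: "subspace (L2_on S)"
  by (simp add: subspace_def L2_on_zero L2_on_add L2_on_scaleR)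

lemma abs_L2_in_L2_on:
  assumes "square_integrable f" "\<And>x. x \<notin> S \<Longrightarrow> f x = 0"
  shows "abs_L2 f \<in> L2_on S"
  using rep_abs_L2_AE[OF assms(1)] assms(2) by (auto simp: L2_on_def elim: eventually_mono)

section \<open>Partial derivatives, smoothness and compact support\<close>

lemma has_derivative_partial:
  assumes "f differentiable at x"
  shows "(f has_derivative (\<lambda>h. \<Sum>i\<in>UNIV. h $ i *\<^sub>R partial i f x)) (at x)"
proof -
  let ?D = "frechet_derivative f (at x)"
  have D: "(f has_derivative ?D) (at x)" using assms by (simp add: frechet_derivative_works)
  then interpret linear ?D by (rule has_derivative_linear)
  have "?D h = (\<Sum>i\<in>UNIV. h $ i *\<^sub>R partial i f x)" for h
    using sum[of "\<lambda>i. h $ i *\<^sub>R axis i 1" UNIV] basis_expansion[of h]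
    by (simp add: partial_def scale scalar_mult_eq_scaleR)
  then show ?thesis using D by (metis (no_types, lifting) ext)
qed

lemma partial_eqI:
  assumes "(f has_derivative D) (at x)"
  shows "partial i f x = D (axis i 1)"
  using frechet_derivative_at[OF assms] by (simp add: partial_def)

lemma partial_add:
  "f differentiable at x \<Longrightarrow> g differentiable at x \<Longrightarrow>
    partial i (\<lambda>x. f x + g x) x = partial i f x + partial i g x"
  by (subst partial_eqI[OF has_derivative_add[OF has_derivative_partial has_derivative_partial]])
    (auto simp: axis_def if_distrib if_distribR sum.If_cases cong: if_cong)

lemma partial_bounded_linear:
  assumes "bounded_linear L" "f differentiable at x"
  shows "partial i (\<lambda>x. L (f x)) x = L (partial i f x)"
  using partial_eqI[OF bounded_linear.has_derivative[OF assms(1)]] assms(2)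
  by (simp add: partial_def frechet_derivative_works)

lemma partial_mult:
  fixes f g :: "real^3 \<Rightarrow> real"
  assumes "f differentiable at x" "g differentiable at x"
  shows "partial i (\<lambda>x. f x * g x) x = f x * partial i g x + partial i f x * g x"
  using partial_eqI[OF has_derivative_mult] assms
  by (simp add: partial_def frechet_derivative_works)

lemma C_k_add: "C_k n f \<Longrightarrow> C_k n g \<Longrightarrow> C_k n (\<lambda>x. f x + g x)"
proof (induction n arbitrary: f g)
  case 0
  then show ?case by (auto intro: continuous_intros)
next
  case (Suc n)
  then have "partial i (\<lambda>x. f x + g x) = (\<lambda>x. partial i f x + partial i g x)" for i
    by (auto simp: partial_add)
  with Suc show ?case by (auto intro: derivative_intros)
qed

lemma C_k_bounded_linear: "bounded_linear L \<Longrightarrow> C_k n f \<Longrightarrow> C_k n (\<lambda>x. L (f x))"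
proof (induction n arbitrary: f)
  case 0
  then show ?case by (auto intro: bounded_linear.continuous_on)
next
  case (Suc n)
  then have "partial i (\<lambda>x. L (f x)) = (\<lambda>x. L (partial i f x))" for i
    by (auto simp: partial_bounded_linear)
  with Suc show ?case
    by (auto intro: bounded_linear_imp_differentiable differentiable_compose)
qed

text \<open>Any compact set outside which the function vanishes can replace the closure of the
  support. Such sets may be enlarged and united, which suits sums and derivatives.\<close>

lemma test_functions_iff:
  "\<phi> \<in> test_functions \<Omega> \<longleftrightarrow>
    (\<forall>n. C_k n \<phi>) \<and> (\<exists>K. compact K \<and> K \<subseteq> \<Omega> \<and> (\<forall>x. x \<notin> K \<longrightarrow> \<phi> x = 0))"
proof -
  have "compact (closure {x. \<phi> x \<noteq> 0}) \<and> closure {x. \<phi> x \<noteq> 0} \<subseteq> \<Omega>"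
    if "compact K" "K \<subseteq> \<Omega>" "\<forall>x. x \<notin> K \<longrightarrow> \<phi> x = 0" for K
  proof -
    have "closure {x. \<phi> x \<noteq> 0} \<subseteq> K"
      using that by (intro closure_minimal) (auto simp: compact_imp_closed)
    then show ?thesis using that by (auto simp: compact_closure intro: bounded_subset compact_imp_bounded)
  qed
  moreover have "\<phi> x = 0" if "x \<notin> closure {x. \<phi> x \<noteq> 0}" for x
    using that closure_subset[of "{x. \<phi> x \<noteq> 0}"] by auto
  ultimately show ?thesis unfolding test_functions_def by blast
qed

lemma test_functionsD:
  assumes "\<phi> \<in> test_functions \<Omega>"
  shows "C_k n \<phi>" "\<phi> differentiable at x" "continuous_on UNIV \<phi>"
    "continuous_on UNIV (partial i \<phi>)" "x \<notin> \<Omega> \<Longrightarrow> \<phi> x = 0"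
proof -
  have C: "C_k n \<phi>" for n using assms by (simp add: test_functions_iff)
  show "C_k n \<phi>" by (rule C)
  show "\<phi> differentiable at x" using C[of 1] by simp
  show "continuous_on UNIV \<phi>" using C[of 0] by simp
  show "continuous_on UNIV (partial i \<phi>)" using C[of 1] by simp
  show "x \<notin> \<Omega> \<Longrightarrow> \<phi> x = 0" using assms by (auto simp: test_functions_iff)
qed

lemma test_functions_mono: "A \<subseteq> B \<Longrightarrow> test_functions A \<subseteq> test_functions B"
  by (auto simp: test_functions_def)

lemma test_functions_add:
  assumes "\<phi> \<in> test_functions \<Omega>" "\<psi> \<in> test_functions \<Omega>"
  shows "(\<lambda>x. \<phi> x + \<psi> x) \<in> test_functions \<Omega>"
proof -
  obtain K L where "compact K" "K \<subseteq> \<Omega>" "\<forall>x. x \<notin> K \<longrightarrow> \<phi> x = 0"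
      "compact L" "L \<subseteq> \<Omega>" "\<forall>x. x \<notin> L \<longrightarrow> \<psi> x = 0"
    using assms by (auto simp: test_functions_iff)
  then show ?thesis
    using assms by (auto simp: test_functions_iff C_k_add intro!: exI[of _ "K \<union> L"])
qed

lemma test_functions_bounded_linear:
  assumes L: "bounded_linear L" and \<phi>: "\<phi> \<in> test_functions \<Omega>"
  shows "(\<lambda>x. L (\<phi> x)) \<in> test_functions \<Omega>"
proof -
  have "L 0 = 0" using L by (rule linear_0[OF bounded_linear.linear])
  moreover obtain K where "compact K" "K \<subseteq> \<Omega>" "\<forall>x. x \<notin> K \<longrightarrow> \<phi> x = 0"
    using \<phi> by (auto simp: test_functions_iff)
  ultimately show ?thesis
    using \<phi> unfolding test_functions_iff
    by (intro conjI allI exI[of _ K]) (auto intro: C_k_bounded_linear[OF L])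
qed

text \<open>The complement of \<open>K\<close> is open, so \<open>f\<close> vanishes in a whole
  neighbourhood of \<open>x\<close>.\<close>

lemma partial_eq_0_outside_closed:
  assumes "closed K" "\<And>x. x \<notin> K \<Longrightarrow> f x = 0" "x \<notin> K"
  shows "partial i f x = 0"
proof -
  have "(f has_derivative (\<lambda>_. 0)) (at x)"
    by (rule has_derivative_transform_within_open[of "\<lambda>_. 0" _ _ _ "- K"])
      (use assms in auto)
  then show ?thesis by (simp add: partial_eqI)
qed

lemma test_functions_partial:
  assumes "\<phi> \<in> test_functions \<Omega>"
  shows "partial i \<phi> \<in> test_functions \<Omega>"
proof -
  have C: "C_k (Suc n) \<phi>" for n using assms by (rule test_functionsD)
  obtain K where K: "compact K" "K \<subseteq> \<Omega>" "\<And>x. x \<notin> K \<Longrightarrow> \<phi> x = 0"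
    using assms by (auto simp: test_functions_iff)
  then have "\<forall>x. x \<notin> K \<longrightarrow> partial i \<phi> x = 0"
    using partial_eq_0_outside_closed[of K \<phi>] by (auto simp: compact_imp_closed)
  then show ?thesis
    using K(1,2) C by (auto simp: test_functions_iff)
qed

lemma integrable_compact_support:
  fixes f :: "real^3 \<Rightarrow> 'b::euclidean_space"
  assumes "continuous_on UNIV f" "compact K" "\<And>x. x \<notin> K \<Longrightarrow> f x = 0"
  shows "integrable lborel f"
proof -
  have "integrable lborel (\<lambda>x. indicator K x *\<^sub>R f x)"
    using assms by (intro borel_integrable_compact) (auto intro: continuous_on_subset)
  moreover have "(\<lambda>x. indicator K x *\<^sub>R f x) = f"
    using assms(3) by (auto simp: indicator_def)
  ultimately show ?thesis by simp
qed

lemma square_integrable_compact_support: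
  assumes "continuous_on UNIV f" "compact K" "\<And>x. x \<notin> K \<Longrightarrow> f x = 0"
  shows "square_integrable f"
  unfolding square_integrable_def
proof
  show "f \<in> borel_measurable lborel"
    using borel_measurable_continuous_onI[OF assms(1)] by simp
  show "integrable lborel (\<lambda>x. (norm (f x))\<^sup>2)"
    using assms by (intro integrable_compact_support[of _ K] continuous_intros) auto
qed

lemma square_integrable_test_function:
  "\<phi> \<in> test_functions \<Omega> \<Longrightarrow> square_integrable \<phi>"
  using square_integrable_compact_support test_functionsD(3) by (metis test_functions_iff)

text \<open>The family is closed under partial derivatives because the
  derivative of $t^{-m} e^{-1/t}$ is $t^{-m-2} e^{-1/t} - m t^{-m-1} e^{-1/t}$.\<close>

definition flat :: "nat \<Rightarrow> real \<Rightarrow> real" where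
  "flat m t = (if t \<le> 0 then 0 else exp (- (1 / t)) / t ^ m)"

text \<open>From the right, substituting \<open>x = 1 / t\<close> turns the limit into that of
  \<open>x ^ m / exp x\<close> at infinity; from the left \<open>flat m\<close> is constantly
  zero.\<close>

lemma flat_tendsto_0: "(flat m \<longlongrightarrow> 0) (at 0)"
proof -
  have "((\<lambda>x::real. x ^ m / exp x) \<longlongrightarrow> 0) at_top" by (rule tendsto_power_div_exp_0)
  then have "((\<lambda>t::real. inverse t ^ m / exp (inverse t)) \<longlongrightarrow> 0) (at_right 0)"
    by (rule filterlim_compose[OF _ filterlim_inverse_at_top_right])
  then have "(flat m \<longlongrightarrow> 0) (at_right 0)"
    by (rule Lim_transform_eventually)
      (auto simp: eventually_at_right_field flat_def exp_minus field_simps intro!: exI[of _ 1])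
  moreover have "(flat m \<longlongrightarrow> 0) (at_left 0)"
    by (rule tendsto_eventually)
      (auto simp: eventually_at_left_field flat_def intro!: exI[of _ "-1"])
  ultimately show ?thesis by (simp add: filterlim_at_split)
qed

lemma flat_has_derivative:
  "(flat m has_real_derivative flat (m + 2) t - real m * flat (m + 1) t) (at t)"
proof -
  consider "t > 0" | "t < 0" | "t = 0" by linarith
  then show ?thesis
  proof cases
    case 1
    have "((\<lambda>t. exp (- (1 / t)) / t ^ m) has_real_derivative
        (exp (- (1 / t)) * (1 / t\<^sup>2) * t ^ m - exp (- (1 / t)) * (real m * t ^ (m - 1))) / (t ^ m * t ^ m)) (at t)"
      using 1 by (auto intro!: derivative_eq_intros simp: power2_eq_square)
    \<comment> \<open>At \<open>m = 0\<close> the exponent \<open>m - 1\<close> is truncated, but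
      its factor \<open>real m\<close> is zero; hence the case distinction on
      \<open>m\<close>.\<close>
    also have "(exp (- (1 / t)) * (1 / t\<^sup>2) * t ^ m - exp (- (1 / t)) * (real m * t ^ (m - 1))) / (t ^ m * t ^ m) =
        flat (m + 2) t - real m * flat (m + 1) t"
      using 1 by (cases m) (simp_all add: flat_def field_simps power2_eq_square)
    finally have "((\<lambda>t. exp (- (1 / t)) / t ^ m) has_real_derivative
        flat (m + 2) t - real m * flat (m + 1) t) (at t)" .
    then show ?thesis
      by (rule has_field_derivative_transform_within_open[where S = "{0<..}"])
        (use 1 in \<open>auto simp: flat_def\<close>)
  next
    case 2
    have "((\<lambda>t. 0) has_real_derivative flat (m + 2) t - real m * flat (m + 1) t) (at t)"
      using 2 by (simp add: flat_def)
    then show ?thesis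
      by (rule has_field_derivative_transform_within_open[where S = "{..<0}"])
        (use 2 in \<open>auto simp: flat_def\<close>)
  next
    case 3
    \<comment> \<open>The difference quotient of \<open>flat m\<close> at the origin equals
      \<open>flat (Suc m)\<close> for every nonzero increment, so its limit is already
      known.\<close>
    have "((\<lambda>h. (flat m (0 + h) - flat m 0) / h) \<longlongrightarrow> 0) (at 0)"
      by (rule Lim_transform_eventually[OF flat_tendsto_0[of "Suc m"]])
        (auto simp: flat_def eventually_at_filter)
    then show ?thesis using 3 by (simp add: DERIV_def flat_def)
  qed
qed

text \<open>An algebra generated syntactically, so that a single rule induction yields
  differentiability together with closure under \<open>partial\<close>; iterating it gives every
  order of smoothness. All indices \<open>m\<close> are included because differentiating
  \<open>flat m\<close> raises the index.\<close>

inductive_set cutoffs :: "(real^3 \<Rightarrow> real) set" where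
  const: "(\<lambda>_. c) \<in> cutoffs"
| coord: "(\<lambda>x. x $ i) \<in> cutoffs"
| add: "f \<in> cutoffs \<Longrightarrow> g \<in> cutoffs \<Longrightarrow> (\<lambda>x. f x + g x) \<in> cutoffs"
| mult: "f \<in> cutoffs \<Longrightarrow> g \<in> cutoffs \<Longrightarrow> (\<lambda>x. f x * g x) \<in> cutoffs"
| flat: "f \<in> cutoffs \<Longrightarrow> (\<lambda>x. flat m (f x)) \<in> cutoffs"

lemma cutoffs_derivative:
  "f \<in> cutoffs \<Longrightarrow> (\<forall>x. f differentiable at x) \<and> (\<forall>i. partial i f \<in> cutoffs)"
proof (induction rule: cutoffs.induct)
  case (const c)
  have "partial i (\<lambda>_. c) = (\<lambda>_. 0)" for i
    by (rule ext, subst partial_eqI[OF has_derivative_const]) simp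
  then show ?case by (simp add: cutoffs.const)
next
  case (coord j)
  have "((\<lambda>x. x $ j) has_derivative (\<lambda>h. h $ j)) (at x)" for x :: "real^3"
    by (rule bounded_linear_imp_has_derivative) (rule bounded_linear_vec_nth)
  note D = this
  have "partial i (\<lambda>x. x $ j) = (\<lambda>_. axis i 1 $ j)" for i
    by (rule ext) (rule partial_eqI[OF D])
  moreover have "(\<lambda>x. x $ j) differentiable at x" for x :: "real^3"
    using D by (auto simp: differentiable_def)
  ultimately show ?case by (simp add: cutoffs.const)
next
  case (add f g)
  then have "partial i (\<lambda>x. f x + g x) = (\<lambda>x. partial i f x + partial i g x)" for i
    by (auto simp: partial_add)
  with add show ?case by (auto intro: cutoffs.add)
next
  case (mult f g)
  then have "partial i (\<lambda>x. f x * g x) = (\<lambda>x. f x * partial i g x + partial i f x * g x)" for i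
    by (auto simp: partial_mult)
  with mult show ?case by (auto intro!: cutoffs.add cutoffs.mult)
next
  case (flat f m)
  have D: "((\<lambda>x. flat m (f x)) has_derivative
      (\<lambda>h. frechet_derivative f (at x) h * (flat (m + 2) (f x) + (- real m) * flat (m + 1) (f x)))) (at x)" for x
    using DERIV_compose_FDERIV[where f = "flat m" and g = f, OF flat_has_derivative] flat
    by (simp add: frechet_derivative_works)
  have P: "partial i (\<lambda>x. flat m (f x)) =
      (\<lambda>x. partial i f x * (flat (m + 2) (f x) + (- real m) * flat (m + 1) (f x)))" for i
    by (rule ext, subst partial_eqI[OF D]) (simp add: partial_def)
  have "(\<lambda>x. partial i f x * (flat (m + 2) (f x) + (- real m) * flat (m + 1) (f x))) \<in> cutoffs" for i
    using flat by (intro cutoffs.add cutoffs.mult cutoffs.const cutoffs.flat) auto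
  then show ?case using D unfolding P differentiable_def by blast
qed

lemma C_k_cutoffs: "f \<in> cutoffs \<Longrightarrow> C_k n f"
proof (induction n arbitrary: f)
  case 0
  then show ?case
    using cutoffs_derivative[OF 0]
    by (auto intro!: continuous_at_imp_continuous_on differentiable_imp_continuous_within)
next
  case (Suc n)
  then show ?case using cutoffs_derivative[OF Suc.prems] by auto
qed

lemma cutoffs_prod: "finite I \<Longrightarrow> (\<And>i. i \<in> I \<Longrightarrow> f i \<in> cutoffs) \<Longrightarrow> (\<lambda>x. \<Prod>i\<in>I. f i x) \<in> cutoffs"
  by (induction I rule: finite_induct) (auto intro: cutoffs.const cutoffs.mult)

text \<open>For positive \<open>t\<close> the values are exp(-1/((n+1) t)), which tend to 1; for
  other \<open>t\<close> the sequence is constantly 0. The limit is thus the indicator of the open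
  half-line.\<close>

lemma flat_0_LIMSEQ: "(\<lambda>n. flat 0 (real (Suc n) * t)) \<longlonglongrightarrow> (if 0 < t then 1 else 0)"
proof (cases "0 < t")
  case True
  have "(\<lambda>n. exp (- (inverse t * inverse (real (Suc n))))) \<longlonglongrightarrow> exp (- (inverse t * 0))"
    by (intro tendsto_intros LIMSEQ_inverse_real_of_nat)
  moreover have "flat 0 (real (Suc n) * t) = exp (- (inverse t * inverse (real (Suc n))))" for n
  proof -
    have "\<not> real (Suc n) * t \<le> 0" using True by (simp add: not_le mult_pos_pos del: of_nat_Suc)
    then show ?thesis by (simp add: flat_def divide_inverse mult.commute del: of_nat_Suc)
  qed
  ultimately show ?thesis using True by simp
next
  case False
  then have "flat 0 (real (Suc n) * t) = 0" for n
    by (simp add: flat_def mult_le_0_iff)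
  then show ?thesis using False by simp
qed

lemma flat_0_bounds: "0 \<le> flat 0 t" "flat 0 t \<le> 1"
  by (auto simp: flat_def)

text \<open>A box is cut out by six half-spaces. Applying \<open>flat 0\<close> to growing multiples
  of the signed distance to each face gives the indicator of the open box in the limit, while every
  member of the sequence vanishes outside the compact \<open>cbox a b\<close>.\<close>

lemma box_cutoff_sequence:
  assumes "cbox a b \<subseteq> \<Omega>"
  obtains \<psi> :: "nat \<Rightarrow> real^3 \<Rightarrow> real" where
    "\<And>n. \<psi> n \<in> test_functions \<Omega>" "\<And>n x. \<bar>\<psi> n x\<bar> \<le> indicator (box a b) x"
    "\<And>x. (\<lambda>n. \<psi> n x) \<longlonglongrightarrow> indicator (box a b) x"
proof -
  define \<psi> where "\<psi> n x = (\<Prod>i\<in>UNIV. flat 0 (real (Suc n) * (x $ i - a $ i)) *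
      flat 0 (real (Suc n) * (b $ i - x $ i)))" for n and x :: "real^3"
  have in_box: "x \<in> box a b \<longleftrightarrow> (\<forall>i. a $ i < x $ i \<and> x $ i < b $ i)" for x
    by (simp add: mem_box_cart)
  have zero: "\<psi> n x = 0" if "x \<notin> box a b" for n x
  proof -
    from that obtain i where i: "x $ i \<le> a $ i \<or> b $ i \<le> x $ i"
      by (auto simp: in_box not_less)
    have "flat 0 (real (Suc n) * (x $ i - a $ i)) * flat 0 (real (Suc n) * (b $ i - x $ i)) = 0"
      using i by (auto simp: flat_def mult_le_0_iff)
    then show ?thesis unfolding \<psi>_def by (intro prod_zero) auto
  qed
  have zero_cbox: "\<psi> n x = 0" if "x \<notin> cbox a b" for n x
    using that zero box_subset_cbox by blast
  have bounds: "0 \<le> \<psi> n x" "\<psi> n x \<le> 1" for n x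
    unfolding \<psi>_def by (auto intro!: prod_nonneg prod_le_1 mult_le_one flat_0_bounds mult_nonneg_nonneg)
  have cut: "(\<lambda>x. flat 0 (real (Suc n) * (x $ i - a $ i))) \<in> cutoffs"
    "(\<lambda>x. flat 0 (real (Suc n) * (b $ i - x $ i))) \<in> cutoffs" for n i
    using cutoffs.flat[OF cutoffs.mult[OF cutoffs.const[of "real (Suc n)"]
          cutoffs.add[OF cutoffs.coord[of i] cutoffs.const[of "- a $ i"]]], of 0]
      cutoffs.flat[OF cutoffs.mult[OF cutoffs.const[of "real (Suc n)"]
          cutoffs.add[OF cutoffs.const[of "b $ i"] cutoffs.mult[OF cutoffs.const[of "- 1"] cutoffs.coord[of i]]]], of 0]
    by simp_all
  have "\<psi> n \<in> cutoffs" for n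
    using cutoffs_prod[of UNIV "\<lambda>i x. flat 0 (real (Suc n) * (x $ i - a $ i)) *
      flat 0 (real (Suc n) * (b $ i - x $ i))"] cut cutoffs.mult
    by (simp add: \<psi>_def[abs_def])
  then have "\<psi> n \<in> test_functions \<Omega>" for n
    using assms zero_cbox unfolding test_functions_iff
    by (intro conjI allI exI[of _ "cbox a b"]) (auto simp: C_k_cutoffs)
  moreover have "\<bar>\<psi> n x\<bar> \<le> indicator (box a b) x" for n x
    using bounds[of n x] zero[of x n] by (auto simp: indicator_def)
  moreover have "(\<lambda>n. \<psi> n x) \<longlonglongrightarrow> indicator (box a b) x" for x
  proof (cases "x \<in> box a b")
    case True
    have "(\<lambda>n. \<psi> n x) \<longlonglongrightarrow> (\<Prod>i\<in>UNIV. (if 0 < x $ i - a $ i then 1 else 0) *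
        (if 0 < b $ i - x $ i then 1 else 0))"
      unfolding \<psi>_def by (intro tendsto_prod tendsto_mult flat_0_LIMSEQ)
    then show ?thesis using True by (simp add: in_box)
  next
    case False
    then show ?thesis by (simp add: zero)
  qed
  ultimately show ?thesis using that by blast
qed

text \<open>Dynkin's argument: open boxes are an intersection-stable generator of the Borel sets,
  and the sets over which \<open>f\<close> has integral zero are closed under complements and
  countable disjoint unions. A function with zero integral over every Borel set vanishes almost
  everywhere.\<close>

lemma integral_boxes_zero_imp_AE_zero:
  fixes f :: "real^3 \<Rightarrow> real"
  assumes f: "integrable lborel f" and box: "\<And>a b. (LINT x:box a b|lborel. f x) = 0"
  shows "AE x in lborel. f x = 0"
proof (rule sigma_finite_measure.density_zero[OF sigma_finite_lborel f])
  let ?G = "range (\<lambda>(a, b). box a b :: (real^3) set)"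
  have "Int_stable ?G"
    by (auto simp: Int_stable_def Int_interval box_Int_box)
  fix A :: "(real^3) set" assume "A \<in> sets lborel"
  then have A: "A \<in> sigma_sets UNIV ?G"
    by (simp add: borel_eq_box)
  have "?G \<subseteq> Pow UNIV" by simp
  from \<open>Int_stable ?G\<close> this A show "(LINT x:A|lborel. f x) = 0"
  proof (induction rule: sigma_sets_induct_disjoint)
    case (basic A)
    then show ?case using box by auto
  next
    case empty
    then show ?case by (simp add: set_lebesgue_integral_def)
  next
    case (compl A)
    have A: "A \<in> sets lborel"
      using compl(1) by (simp add: borel_eq_box)
    \<comment> \<open>The complement step requires the integral over the whole space, obtained by
      exhausting it with growing cubes centred at the origin.\<close>
    have total: "(LINT x|lborel. f x) = 0"
    proof -
      have "(\<lambda>n. LINT x:box (- (real n *\<^sub>R One)) (real n *\<^sub>R One)|lborel. f x) \<longlonglongrightarrow>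
          (LINT x:(\<Union>n. box (- (real n *\<^sub>R One)) (real n *\<^sub>R One))|lborel. f x)"
        by (rule set_integral_cont_up)
          (auto simp: incseq_def mem_box UN_box_eq_UNIV set_integrable_def f
            intro!: subset_box_imp integrable_mult_indicator)
      then show ?thesis
        using box by (simp add: UN_box_eq_UNIV set_lebesgue_integral_def LIMSEQ_const_iff)
    qed
    have "(LINT x:UNIV - A|lborel. f x) = (LINT x|lborel. f x) - (LINT x:A|lborel. f x)"
      unfolding set_lebesgue_integral_def
      by (subst Bochner_Integration.integral_diff[OF f integrable_mult_indicator[OF A f], symmetric])
        (auto simp: indicator_def intro!: Bochner_Integration.integral_cong)
    then show ?case using total compl by simp
  next
    case (union A)
    have A: "A n \<in> sets lborel" for n using union(2) by (auto simp: borel_eq_box)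
    then have UA: "(\<Union>n. A n) \<in> sets lborel" by blast
    have "(LINT x:(\<Union>i. A i)|lborel. f x) = (\<Sum>n. LINT x:A n|lborel. f x)"
      using union(1) A integrable_mult_indicator[OF UA f]
      by (intro lebesgue_integral_countable_add) (auto simp: disjoint_family_on_def set_integrable_def)
    then show ?case using union by simp
  qed
qed

lemma integrable_mult_square_integrable:
  "square_integrable f \<Longrightarrow> square_integrable g \<Longrightarrow> integrable lborel (\<lambda>x. f x * g x :: real)"
  using integrable_inner_square_integrable[of f g] by simp

lemma square_integrable_indicator_box: "square_integrable (indicator (box a b) :: real^3 \<Rightarrow> real)"
proof -
  have "(\<lambda>x. (norm (indicator (box a b) x :: real))\<^sup>2) = indicator (box a b)"
    by (auto simp: indicator_def)
  moreover have "integrable lborel (indicator (box a b) :: real^3 \<Rightarrow> real)"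
    by (rule integrable_real_indicator) (simp, rule emeasure_bounded_finite, rule bounded_box)
  ultimately show ?thesis
    by (simp add: square_integrable_def)
qed

text \<open>Dominated convergence along the cutoffs makes the integral of \<open>f\<close> vanish
  over each \<open>box a b\<close> with \<open>cbox a b\<close> inside \<open>\<Omega>\<close>. This
  forces \<open>f\<close> to be zero almost everywhere on every such box, and countably many of them
  cover \<open>\<Omega>\<close>.\<close>

lemma fundamental_lemma_variations:
  fixes f :: "real^3 \<Rightarrow> real"
  assumes "open \<Omega>" and f: "square_integrable f"
    and zero: "\<And>\<psi>. \<psi> \<in> test_functions \<Omega> \<Longrightarrow> (LINT x|lborel. f x * \<psi> x) = 0"
  shows "AE x in lborel. x \<in> \<Omega> \<longrightarrow> f x = 0"
proof -
  have [measurable]: "f \<in> borel_measurable borel"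
    using f by (simp add: square_integrable_def)
  have int: "integrable lborel (\<lambda>x. indicator (box a b) x * f x)" for a b
    using integrable_mult_square_integrable[OF square_integrable_indicator_box f] .
  have box0: "(LINT x|lborel. indicator (box a b) x * f x) = 0" if ab: "cbox a b \<subseteq> \<Omega>" for a b
  proof -
    obtain \<psi> :: "nat \<Rightarrow> real^3 \<Rightarrow> real" where \<psi>: "\<And>n. \<psi> n \<in> test_functions \<Omega>"
      "\<And>n x. \<bar>\<psi> n x\<bar> \<le> indicator (box a b) x"
      "\<And>x. (\<lambda>n. \<psi> n x) \<longlonglongrightarrow> indicator (box a b) x"
      using box_cutoff_sequence[OF ab] by blast
    have [measurable]: "\<psi> n \<in> borel_measurable borel" for n
      using square_integrable_test_function[OF \<psi>(1)] by (simp add: square_integrable_def)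
    have "(\<lambda>n. LINT x|lborel. \<psi> n x * f x) \<longlonglongrightarrow> (LINT x|lborel. indicator (box a b) x * f x)"
    proof (rule integral_dominated_convergence)
      show "integrable lborel (\<lambda>x. norm (indicator (box a b) x * f x))" using int by simp
      show "AE x in lborel. norm (\<psi> n x * f x) \<le> norm (indicator (box a b) x * f x)" for n
        using \<psi>(2) by (auto simp: abs_mult intro!: AE_I2 mult_right_mono)
    qed (auto intro!: AE_I2 tendsto_mult \<psi>(3))
    moreover have "(LINT x|lborel. \<psi> n x * f x) = 0" for n
      using zero[OF \<psi>(1)[of n]] by (simp add: mult.commute)
    ultimately show ?thesis by (simp add: LIMSEQ_const_iff)
  qed
  define F where "F = {box a b | a b. cbox a b \<subseteq> \<Omega>}"
  have AE_box: "AE x in lborel. x \<in> X \<longrightarrow> f x = 0" if "X \<in> F" for X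
  proof -
    obtain a b where X: "X = box a b" and ab: "cbox a b \<subseteq> \<Omega>" using \<open>X \<in> F\<close> by (auto simp: F_def)
    have "AE x in lborel. indicator X x * f x = 0"
    proof (rule integral_boxes_zero_imp_AE_zero)
      show "integrable lborel (\<lambda>x. indicator X x * f x)" using int X by simp
      fix c d
      \<comment> \<open>Open and closed boxes intersect by the same corner formula, so the
        intersection is a box whose closed counterpart is still inside
        \<open>\<Omega>\<close>.\<close>
      obtain e g where eg: "box a b \<inter> box c d = box e g" "cbox a b \<inter> cbox c d = cbox e g"
        using box_Int_box[of a b c d] Int_interval[of a b c d] by blast
      have "(LINT x:box c d|lborel. indicator X x * f x) = (LINT x|lborel. indicator (box e g) x * f x)"
        unfolding set_lebesgue_integral_def X eg(1)[symmetric]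
        by (rule Bochner_Integration.integral_cong) (auto simp: indicator_def)
      also have "\<dots> = 0" using eg(2) ab by (intro box0) auto
      finally show "(LINT x:box c d|lborel. indicator X x * f x) = 0" .
    qed
    then show ?thesis by (auto elim!: eventually_mono simp: indicator_def)
  qed
  \<comment> \<open>The exceptional null sets may be united only after passing to a countable
    subcover.\<close>
  obtain F' where F': "F' \<subseteq> F" "countable F'" "\<Union>F' = \<Union>F"
    using Lindelof[of F] by (auto simp: F_def)
  have "\<Omega> \<subseteq> \<Union>F"
  proof
    fix x assume "x \<in> \<Omega>"
    then obtain a b where "x \<in> box a b" "cbox a b \<subseteq> \<Omega>"
      using open_contains_cbox \<open>open \<Omega>\<close> by metis
    then show "x \<in> \<Union>F" by (auto simp: F_def)
  qed
  moreover have "AE x in lborel. \<forall>X\<in>F'. x \<in> X \<longrightarrow> f x = 0"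
    using F' AE_box by (subst AE_ball_countable) auto
  ultimately show ?thesis using F'(3) by (auto elim!: eventually_mono)
qed

text \<open>Testing with scalar test functions times basis vectors reduces the claim on
  \<open>\<Omega>\<close> to the scalar case; outside, the values are zero by membership in
  \<open>L2_on \<Omega>\<close>.\<close>

lemma L2_eq_0_if_orthogonal_test_functions:
  fixes g :: "('b::euclidean_space) L2"
  assumes "open \<Omega>" and g: "g \<in> L2_on \<Omega>"
    and orth: "\<And>\<phi>. \<phi> \<in> test_functions \<Omega> \<Longrightarrow> inner g (abs_L2 \<phi>) = 0"
  shows "g = 0"
proof -
  have comp: "AE x in lborel. x \<in> \<Omega> \<longrightarrow> rep_L2 g x \<bullet> b = 0" if "b \<in> Basis" for b
  proof (rule fundamental_lemma_variations[OF \<open>open \<Omega>\<close>])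
    have "integrable lborel (\<lambda>x. (rep_L2 g x \<bullet> b)\<^sup>2)"
    proof (rule Bochner_Integration.integrable_bound)
      show "integrable lborel (\<lambda>x. (norm (rep_L2 g x))\<^sup>2)"
        using square_integrable_rep[of g] by (simp add: square_integrable_def)
      show "AE x in lborel. norm ((rep_L2 g x \<bullet> b)\<^sup>2) \<le> norm ((norm (rep_L2 g x))\<^sup>2)"
        using Basis_le_norm[OF that] by (auto simp: abs_le_square_iff[symmetric])
    qed simp
    then show "square_integrable (\<lambda>x. rep_L2 g x \<bullet> b)"
      by (simp add: square_integrable_def)
    fix \<psi> :: "real^3 \<Rightarrow> real" assume \<psi>: "\<psi> \<in> test_functions \<Omega>"
    have t: "(\<lambda>x. \<psi> x *\<^sub>R b) \<in> test_functions \<Omega>"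
      by (rule test_functions_bounded_linear[OF bounded_linear_scaleR_left \<psi>])
    show "(LINT x|lborel. (rep_L2 g x \<bullet> b) * \<psi> x) = 0"
      using orth[OF t] inner_L2_abs[OF square_integrable_test_function[OF t], of g]
      by (simp add: mult.commute)
  qed
  have "AE x in lborel. \<forall>b\<in>Basis. x \<in> \<Omega> \<longrightarrow> rep_L2 g x \<bullet> b = 0"
    using comp by (intro AE_ball_countable[THEN iffD2]) (auto simp: countable_finite)
  moreover have "AE x in lborel. x \<notin> \<Omega> \<longrightarrow> rep_L2 g x = 0"
    using g by (simp add: L2_on_def)
  moreover note rep_L2_zero_AE[where 'a = 'b]
  ultimately have "AE x in lborel. rep_L2 g x = rep_L2 0 x"
    by eventually_elim (metis euclidean_all_zero_iff)
  then show ?thesis by (rule L2_eqI)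
qed

section \<open>Integration by parts and weak derivatives\<close>

lemma integral_translation:
  fixes f :: "real^3 \<Rightarrow> real"
  assumes [measurable]: "f \<in> borel_measurable borel"
  shows "(LINT x|lborel. f (x + c)) = (LINT x|lborel. f x)"
proof -
  have "(LINT x|lborel. f x) = (LINT x|distr lborel borel ((+) c). f x)"
    by (simp add: lborel_distr_plus)
  also have "\<dots> = (LINT x|lborel. f (x + c))"
    by (subst integral_distr) (auto simp: add.commute)
  finally show ?thesis ..
qed

lemma integrable_translation:
  fixes f :: "real^3 \<Rightarrow> real"
  assumes "integrable lborel f"
  shows "integrable lborel (\<lambda>x. f (x + c))"
proof -
  have "integrable (distr lborel borel ((+) c)) f" using assms by (simp add: lborel_distr_plus)
  then have "integrable lborel (\<lambda>x. f (c + x))"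
    using assms by (subst (asm) integrable_distr_eq) auto
  then show ?thesis by (simp add: add.commute)
qed

text \<open>Forward difference quotient with step 1/(n+1). For integrable \<open>f\<close> its
  integral is zero by translation invariance of Lebesgue measure; integration by parts is the limit
  of this fact.\<close>

definition dquot :: "nat \<Rightarrow> 3 \<Rightarrow> (real^3 \<Rightarrow> real) \<Rightarrow> real^3 \<Rightarrow> real" where
  "dquot n i f x = real (Suc n) * (f (x + inverse (real (Suc n)) *\<^sub>R axis i 1) - f x)"

text \<open>Serves twice: the intermediate point tends to \<open>x\<close>, which gives pointwise
  convergence, and a bound for \<open>partial i f\<close> bounds all quotients at once.\<close>

lemma dquot_mean_value:
  assumes "\<And>x. f differentiable at x"
  obtains z where "0 < z" "z < inverse (real (Suc n))" "dquot n i f x = partial i f (x + z *\<^sub>R axis i 1)"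
proof -
  let ?h = "inverse (real (Suc n))"
  have D: "((\<lambda>t. f (x + t *\<^sub>R axis i 1)) has_real_derivative partial i f (x + t *\<^sub>R axis i 1)) (at t)" for t
  proof -
    let ?D = "frechet_derivative f (at (x + t *\<^sub>R axis i 1))"
    have f': "(f has_derivative ?D) (at (x + t *\<^sub>R axis i 1))"
      using assms by (simp add: frechet_derivative_works)
    have "((\<lambda>t. x + t *\<^sub>R axis i 1) has_derivative (\<lambda>s. s *\<^sub>R axis i (1::real))) (at t)"
      by (auto intro!: derivative_eq_intros)
    from has_derivative_compose[OF this f'] show ?thesis
      using linear_scale[OF has_derivative_linear[OF f']]
      by (simp add: has_field_derivative_def partial_def mult_commute_abs)
  qed
  obtain z where z: "0 < z" "z < ?h"
    "f (x + ?h *\<^sub>R axis i 1) - f (x + 0 *\<^sub>R axis i 1) = (?h - 0) * partial i f (x + z *\<^sub>R axis i 1)"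
    using MVT2[of 0 ?h "\<lambda>t. f (x + t *\<^sub>R axis i 1)" "\<lambda>t. partial i f (x + t *\<^sub>R axis i 1)"] D
    by auto
  then have "dquot n i f x = partial i f (x + z *\<^sub>R axis i 1)"
    by (simp add: dquot_def field_simps)
  then show ?thesis using that z by blast
qed

lemma dquot_LIMSEQ:
  assumes f: "\<And>x. f differentiable at x" and cont: "continuous_on UNIV (partial i f)"
  shows "(\<lambda>n. dquot n i f x) \<longlonglongrightarrow> partial i f x"
proof -
  have "\<forall>n. \<exists>z. 0 < z \<and> z < inverse (real (Suc n)) \<and> dquot n i f x = partial i f (x + z *\<^sub>R axis i 1)"
    by (intro allI) (rule dquot_mean_value[where f = f, OF f], blast)
  then obtain z where z: "\<And>n. 0 < z n" "\<And>n. z n < inverse (real (Suc n))"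
    "\<And>n. dquot n i f x = partial i f (x + z n *\<^sub>R axis i 1)" by metis
  have "z \<longlonglongrightarrow> 0"
    by (rule tendsto_sandwich[OF _ _ tendsto_const LIMSEQ_inverse_real_of_nat])
      (use z in \<open>auto intro!: always_eventually less_imp_le\<close>)
  then have "(\<lambda>n. x + z n *\<^sub>R axis i 1) \<longlonglongrightarrow> x + 0 *\<^sub>R axis i 1"
    by (intro tendsto_intros)
  then have lim: "(\<lambda>n. x + z n *\<^sub>R axis i 1) \<longlonglongrightarrow> x" by simp
  have "(\<lambda>n. partial i f (x + z n *\<^sub>R axis i 1)) \<longlonglongrightarrow> partial i f x"
    by (rule continuous_on_tendsto_compose[OF cont lim]) simp_all
  then show ?thesis by (simp only: z(3))
qed

text \<open>Dominated convergence: the quotients are bounded by a bound \<open>M\<close> of the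
  derivative, and since the step is at most 1 they all vanish outside the ball of radius
  \<open>R + 1\<close> when \<open>K\<close> lies in the ball of radius \<open>R\<close>.\<close>

lemma integral_dquot_LIMSEQ:
  assumes f: "\<And>x. f differentiable at x" and cont: "continuous_on UNIV (partial i f)"
    and K: "compact K" "\<And>x. x \<notin> K \<Longrightarrow> f x = 0" and h: "continuous_on UNIV h"
  shows "(\<lambda>n. LINT x|lborel. dquot n i f x * h x) \<longlonglongrightarrow> (LINT x|lborel. partial i f x * h x)"
proof -
  obtain R where R: "K \<subseteq> cball 0 R"
    using compact_imp_bounded[OF K(1)] unfolding bounded_iff subset_iff mem_cball_0 by blast
  have "bounded (partial i f ` K)"
    by (rule compact_imp_bounded[OF compact_continuous_image[OF continuous_on_subset[OF cont] K(1)]]) simp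
  then obtain M0 where M0: "\<And>x. x \<in> K \<Longrightarrow> \<bar>partial i f x\<bar> \<le> M0"
    by (auto simp: bounded_iff)
  \<comment> \<open>The maximum with 0 covers points outside \<open>K\<close>, where the derivative
    vanishes, and an empty \<open>K\<close>, for which \<open>M0\<close> may be negative.\<close>
  define M where "M = max M0 0"
  have M: "\<bar>partial i f x\<bar> \<le> M" for x
    using M0[of x] partial_eq_0_outside_closed[OF compact_imp_closed[OF K(1)] K(2), where x = x and i = i]
    by (cases "x \<in> K") (auto simp: M_def)
  have bound: "\<bar>dquot n i f x\<bar> \<le> M * indicator (cball 0 (R + 1)) x" for n x
  proof (cases "x \<in> cball 0 (R + 1)")
    case True
    obtain z where "dquot n i f x = partial i f (x + z *\<^sub>R axis i 1)"
      using dquot_mean_value[where f = f, OF f] by blast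
    then show ?thesis using M True by simp
  next
    case False
    have "norm (inverse (real (Suc n)) *\<^sub>R axis i (1::real)) \<le> 1"
      by (simp add: divide_simps)
    then have "R < norm (x + inverse (real (Suc n)) *\<^sub>R axis i 1)"
      using False norm_triangle_ineq4[of "x + inverse (real (Suc n)) *\<^sub>R axis i 1"
          "inverse (real (Suc n)) *\<^sub>R axis i 1"] by simp
    then have "f (x + inverse (real (Suc n)) *\<^sub>R axis i 1) = 0"
      using R by (intro K(2)) auto
    moreover have "f x = 0" using False R by (intro K(2)) auto
    moreover have "0 \<le> M * indicator (cball 0 (R + 1)) x"
      by (intro mult_nonneg_nonneg) (auto simp: M_def)
    ultimately show ?thesis by (simp add: dquot_def)
  qed
  have [measurable]: "f \<in> borel_measurable borel"
    using f by (intro borel_measurable_continuous_onI continuous_at_imp_continuous_on)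
      (auto intro: differentiable_imp_continuous_within)
  have [measurable]: "partial i f \<in> borel_measurable borel" "h \<in> borel_measurable borel"
    using cont h by (auto intro: borel_measurable_continuous_onI)
  have [measurable]: "dquot n i f \<in> borel_measurable borel" for n
    unfolding dquot_def[abs_def] by measurable
  show ?thesis
  proof (rule integral_dominated_convergence[where w = "\<lambda>x. M * norm (indicator (cball 0 (R + 1)) x *\<^sub>R h x)"])
    show "integrable lborel (\<lambda>x. M * norm (indicator (cball 0 (R + 1)) x *\<^sub>R h x))"
      using h by (intro integrable_mult_right integrable_norm borel_integrable_compact)
        (auto intro: continuous_on_subset)
    show "AE x in lborel. norm (dquot n i f x * h x) \<le> M * norm (indicator (cball 0 (R + 1)) x *\<^sub>R h x)" for n
    proof (rule AE_I2)
      fix x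
      show "norm (dquot n i f x * h x) \<le> M * norm (indicator (cball 0 (R + 1)) x *\<^sub>R h x)"
        using mult_right_mono[OF bound[of n x], of "\<bar>h x\<bar>"] by (simp add: abs_mult mult.assoc)
    qed
  qed (auto intro!: AE_I2 tendsto_mult dquot_LIMSEQ[OF f cont])
qed

lemma integral_partial_eq_0:
  assumes f: "\<And>x. f differentiable at x" and cont: "continuous_on UNIV (partial i f)"
    and K: "compact K" "\<And>x. x \<notin> K \<Longrightarrow> f x = (0::real)"
  shows "(LINT x|lborel. partial i f x) = 0"
proof -
  have contf: "continuous_on UNIV f"
    using f by (auto intro!: continuous_at_imp_continuous_on differentiable_imp_continuous_within)
  have int: "integrable lborel f" using integrable_compact_support[OF contf K] .
  have "(LINT x|lborel. dquot n i f x) = 0" for n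
    using int integrable_translation[OF int] integral_translation[of f]
    by (simp add: dquot_def integral_diff del: of_nat_Suc)
  then show ?thesis
    using integral_dquot_LIMSEQ[OF f cont K, of "\<lambda>_. 1"] by (simp add: LIMSEQ_const_iff)
qed

text \<open>The product rule, integrated. Compact support is asked of \<open>f\<close> alone, so
  that a weight such as \<open>arctan (x $ 1)\<close> can take the place of
  \<open>g\<close>.\<close>

lemma integration_by_parts:
  fixes f g :: "real^3 \<Rightarrow> real"
  assumes f: "\<And>x. f differentiable at x" and cf: "continuous_on UNIV (partial i f)"
    and g: "\<And>x. g differentiable at x" and cg: "continuous_on UNIV (partial i g)"
    and K: "compact K" "\<And>x. x \<notin> K \<Longrightarrow> f x = 0"
  shows "(LINT x|lborel. partial i f x * g x) = - (LINT x|lborel. f x * partial i g x)"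
proof -
  have cont: "continuous_on UNIV f" "continuous_on UNIV g"
    using f g by (auto intro!: continuous_at_imp_continuous_on differentiable_imp_continuous_within)
  have K': "partial i f x = 0" if "x \<notin> K" for x
    using partial_eq_0_outside_closed[OF compact_imp_closed[OF K(1)] K(2) that] by simp
  have p: "partial i (\<lambda>x. f x * g x) = (\<lambda>x. f x * partial i g x + partial i f x * g x)"
    using f g by (auto simp: partial_mult)
  have "(LINT x|lborel. partial i (\<lambda>x. f x * g x) x) = 0"
    using f g K by (intro integral_partial_eq_0[of _ _ K]) (auto simp: p intro!: continuous_intros cont cf cg)
  moreover have "integrable lborel (\<lambda>x. f x * partial i g x)" "integrable lborel (\<lambda>x. partial i f x * g x)"
    using K K' by (auto intro!: integrable_compact_support[of _ K] continuous_intros cont cf cg)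
  ultimately show ?thesis by (simp add: p)
qed

lemma integration_by_parts_test:
  fixes f g :: "real^3 \<Rightarrow> real"
  assumes f: "f \<in> test_functions \<Omega>" and g: "g \<in> test_functions \<Omega>'"
  shows "(LINT x|lborel. partial i f x * g x) = - (LINT x|lborel. f x * partial i g x)"
proof -
  obtain K where "compact K" "\<And>x. x \<notin> K \<Longrightarrow> f x = 0" using f by (auto simp: test_functions_iff)
  then show ?thesis
    using f g by (intro integration_by_parts[of _ _ _ K]) (auto intro: test_functionsD)
qed

text \<open>The symmetry is inherited from difference quotients, which commute with \<open>partial\<close>.\<close>

lemma integral_partial_partial_commute:
  fixes f g :: "real^3 \<Rightarrow> real"
  assumes f: "f \<in> test_functions \<Omega>" and g: "g \<in> test_functions \<Omega>'"
  shows "(LINT x|lborel. partial i f x * partial j g x) = (LINT x|lborel. partial j f x * partial i g x)"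
proof -
  obtain K where K: "compact K" "\<And>x. x \<notin> K \<Longrightarrow> f x = 0" using f by (auto simp: test_functions_iff)
  obtain L where L: "compact L" "\<And>x. x \<notin> L \<Longrightarrow> g x = 0" using g by (auto simp: test_functions_iff)
  note fD = test_functionsD[OF f] and gD = test_functionsD[OF g]
  note pf = test_functions_partial[OF f, of j]
  note pfD = test_functionsD[OF pf]
  have Kj: "partial j f x = 0" if "x \<notin> K" for x
    using partial_eq_0_outside_closed[OF compact_imp_closed[OF K(1)] K(2) that] by simp
  have step: "(LINT x|lborel. dquot n i f x * partial j g x) = - (LINT x|lborel. dquot n i (partial j f) x * g x)" for n
  proof -
    let ?c = "inverse (real (Suc n)) *\<^sub>R axis i (1::real)"
    have tr: "((\<lambda>x. f (x + ?c)) has_derivative frechet_derivative f (at (x + ?c))) (at x)" for x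
    proof -
      have "((\<lambda>x. x + ?c) has_derivative (\<lambda>h. h)) (at x)" by (auto intro!: derivative_eq_intros)
      from has_derivative_compose[OF this fD(2)[unfolded frechet_derivative_works]] show ?thesis .
    qed
    have D: "(dquot n i f has_derivative (\<lambda>h. real (Suc n) * (frechet_derivative f (at (x + ?c)) h
        - frechet_derivative f (at x) h))) (at x)" for x
      unfolding dquot_def[abs_def] using tr fD(2)
      by (intro has_derivative_mult_right has_derivative_diff) (auto simp: frechet_derivative_works)
    \<comment> \<open>Shifts and constant factors commute with \<open>partial j\<close>, so no
      second derivatives of \<open>f\<close> are interchanged here.\<close>
    have P: "partial j (dquot n i f) = dquot n i (partial j f)"
      by (rule ext, subst partial_eqI[OF D]) (simp add: dquot_def partial_def)
    have "(LINT x|lborel. partial j g x * dquot n i f x) = - (LINT x|lborel. g x * partial j (dquot n i f) x)"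
    proof (rule integration_by_parts[OF gD(2,4) _ _ L])
      show "dquot n i f differentiable at x" for x using D by (auto simp: differentiable_def)
      show "continuous_on UNIV (partial j (dquot n i f))"
        unfolding P unfolding dquot_def[abs_def]
        by (intro continuous_intros pfD(3) continuous_on_compose2[OF pfD(3)]) auto
    qed auto
    then show ?thesis by (simp add: P mult.commute)
  qed
  \<comment> \<open>Both sides of \<open>step\<close> converge. The limit has
    \<open>partial i (partial j f)\<close> on the right, and one more integration by parts, in
    direction \<open>i\<close>, moves that outer derivative to \<open>g\<close>.\<close>
  have "(\<lambda>n. LINT x|lborel. dquot n i f x * partial j g x) \<longlonglongrightarrow> (LINT x|lborel. partial i f x * partial j g x)"
    by (rule integral_dquot_LIMSEQ[OF fD(2,4) K gD(4)]) auto
  moreover have "(\<lambda>n. - (LINT x|lborel. dquot n i (partial j f) x * g x)) \<longlonglongrightarrow>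
      - (LINT x|lborel. partial i (partial j f) x * g x)"
    by (rule tendsto_minus, rule integral_dquot_LIMSEQ[OF pfD(2,4) K(1) Kj gD(3)]) auto
  ultimately have "(LINT x|lborel. partial i f x * partial j g x) = - (LINT x|lborel. partial i (partial j f) x * g x)"
    using step LIMSEQ_unique by auto
  also have "\<dots> = (LINT x|lborel. partial j f x * partial i g x)"
    using integration_by_parts_test[OF pf g, of i] by simp
  finally show ?thesis .
qed

section \<open>Gradient, curl and divergence of test functions\<close>

lemma partial_component:
  fixes F :: "real^3 \<Rightarrow> real^3"
  shows "F differentiable at x \<Longrightarrow> partial i F x $ k = partial i (\<lambda>x. F x $ k) x"
  by (rule partial_bounded_linear[OF bounded_linear_vec_nth, symmetric])

lemma test_functions_component:
  "F \<in> test_functions \<Omega> \<Longrightarrow> (\<lambda>x. F x $ k :: real) \<in> test_functions \<Omega>"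
  by (rule test_functions_bounded_linear[OF bounded_linear_vec_nth])

lemma test_functions_vecI:
  fixes F :: "real^3 \<Rightarrow> real^3"
  assumes "\<And>k. (\<lambda>x. F x $ k) \<in> test_functions \<Omega>"
  shows "F \<in> test_functions \<Omega>"
proof -
  have "(\<lambda>x. F x $ k *\<^sub>R axis k 1 :: real^3) \<in> test_functions \<Omega>" for k
    by (rule test_functions_bounded_linear[OF bounded_linear_scaleR_left assms])
  then have "(\<lambda>x. F x $ 1 *\<^sub>R axis 1 1 + F x $ 2 *\<^sub>R axis 2 1 + F x $ 3 *\<^sub>R axis 3 1 :: real^3) \<in> test_functions \<Omega>"
    by (intro test_functions_add)
  moreover have "(\<lambda>x. F x $ 1 *\<^sub>R axis 1 1 + F x $ 2 *\<^sub>R axis 2 1 + F x $ 3 *\<^sub>R axis 3 1 :: real^3) = F"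
    by (rule ext) (simp add: vec_eq_iff forall_3 axis_def)
  ultimately show ?thesis by simp
qed

lemma test_functions_diff:
  assumes "f \<in> test_functions \<Omega>" "g \<in> test_functions \<Omega>"
  shows "(\<lambda>x. f x - g x) \<in> test_functions \<Omega>"
proof -
  have "(\<lambda>x. - g x) \<in> test_functions \<Omega>"
    by (rule test_functions_bounded_linear[OF bounded_linear_minus[OF bounded_linear_ident] assms(2)])
  from test_functions_add[OF assms(1) this] show ?thesis by simp
qed

lemma classical_div_components:
  "F \<in> test_functions \<Omega> \<Longrightarrow> classical_div F x = (\<Sum>i\<in>UNIV. partial i (\<lambda>x. F x $ i) x)"
  by (simp add: classical_div_def partial_component test_functionsD(2))

lemma classical_curl_components:
  assumes "F \<in> test_functions \<Omega>"
  shows "classical_curl F x $ 1 = partial 2 (\<lambda>x. F x $ 3) x - partial 3 (\<lambda>x. F x $ 2) x"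
    "classical_curl F x $ 2 = partial 3 (\<lambda>x. F x $ 1) x - partial 1 (\<lambda>x. F x $ 3) x"
    "classical_curl F x $ 3 = partial 1 (\<lambda>x. F x $ 2) x - partial 2 (\<lambda>x. F x $ 1) x"
  using partial_component[OF test_functionsD(2)[OF assms], symmetric]
  by (simp_all add: classical_curl_def)

lemma test_functions_grad:
  "\<phi> \<in> test_functions \<Omega> \<Longrightarrow> classical_grad \<phi> \<in> test_functions \<Omega>"
  by (rule test_functions_vecI) (simp add: classical_grad_def test_functions_partial[unfolded atomize_eq])

lemma test_functions_curl:
  assumes F: "F \<in> test_functions \<Omega>"
  shows "classical_curl F \<in> test_functions \<Omega>"
proof (rule test_functions_vecI)
  fix k :: 3
  have "(\<lambda>x. partial i (\<lambda>x. F x $ k) x - partial j (\<lambda>x. F x $ l) x) \<in> test_functions \<Omega>" for i j k l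
    by (intro test_functions_diff test_functions_partial test_functions_component F)
  then show "(\<lambda>x. classical_curl F x $ k) \<in> test_functions \<Omega>"
    using exhaust_3[of k] by (auto simp: classical_curl_components[OF F])
qed

lemma test_functions_div:
  assumes F: "F \<in> test_functions \<Omega>"
  shows "classical_div F \<in> test_functions \<Omega>"
proof -
  have "classical_div F = (\<lambda>x. partial 1 (\<lambda>x. F x $ 1) x + partial 2 (\<lambda>x. F x $ 2) x + partial 3 (\<lambda>x. F x $ 3) x)"
    by (rule ext) (simp add: classical_div_components[OF F] sum_3)
  then show ?thesis
    by (simp only:) (intro test_functions_add test_functions_partial test_functions_component F)
qed

lemma integrable_mult_test:
  "f \<in> test_functions \<Omega> \<Longrightarrow> g \<in> test_functions \<Omega>' \<Longrightarrow> integrable lborel (\<lambda>x. f x * g x :: real)"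
  by (intro integrable_mult_square_integrable square_integrable_test_function)

lemma inner_abs_L2_vec:
  fixes F G :: "real^3 \<Rightarrow> real^3"
  assumes F: "F \<in> test_functions \<Omega>" and G: "G \<in> test_functions \<Omega>'"
  shows "inner (abs_L2 F) (abs_L2 G) = (\<Sum>k\<in>UNIV. LINT x|lborel. F x $ k * G x $ k)"
proof -
  have "integrable lborel (\<lambda>x. F x $ k * G x $ k)" for k
    by (rule integrable_mult_test[OF test_functions_component[OF F] test_functions_component[OF G]])
  then show ?thesis
    using F G by (simp add: inner_abs_L2 square_integrable_test_function inner_vec_def)
qed

lemma inner_abs_L2_real:
  fixes f g :: "real^3 \<Rightarrow> real"
  assumes "f \<in> test_functions \<Omega>" "g \<in> test_functions \<Omega>'"
  shows "inner (abs_L2 f) (abs_L2 g) = (LINT x|lborel. f x * g x)"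
  using assms by (simp add: inner_abs_L2 square_integrable_test_function)

lemma abs_L2_test_in_L2_on: "\<phi> \<in> test_functions \<Omega> \<Longrightarrow> abs_L2 \<phi> \<in> L2_on \<Omega>"
  by (rule abs_L2_in_L2_on) (auto simp: square_integrable_test_function test_functionsD(5))

text \<open>Integration by parts in each component. The result makes the approximating sequences in
  \<open>H1_0\<close> explicit, since their weak gradients become classical ones.\<close>

lemma has_weak_grad_test:
  assumes \<phi>: "\<phi> \<in> test_functions \<Omega>"
  shows "has_weak_grad \<Omega> (abs_L2 \<phi>) (abs_L2 (classical_grad \<phi>))"
  unfolding has_weak_grad_def
proof (intro conjI ballI)
  fix \<psi> :: "real^3 \<Rightarrow> real^3" assume \<psi>: "\<psi> \<in> test_functions \<Omega>"
  have "inner (abs_L2 (classical_grad \<phi>)) (abs_L2 \<psi>) = (\<Sum>k\<in>UNIV. LINT x|lborel. partial k \<phi> x * \<psi> x $ k)"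
    by (simp add: inner_abs_L2_vec[OF test_functions_grad[OF \<phi>] \<psi>] classical_grad_def)
  also have "\<dots> = - (\<Sum>k\<in>UNIV. LINT x|lborel. \<phi> x * partial k (\<lambda>x. \<psi> x $ k) x)"
    by (simp add: integration_by_parts_test[OF \<phi> test_functions_component[OF \<psi>]] sum_negf)
  also have "(\<Sum>k\<in>UNIV. LINT x|lborel. \<phi> x * partial k (\<lambda>x. \<psi> x $ k) x) =
      (LINT x|lborel. \<phi> x * classical_div \<psi> x)"
    unfolding classical_div_components[OF \<psi>] sum_distrib_left
    by (rule Bochner_Integration.integral_sum[symmetric])
      (rule integrable_mult_test[OF \<phi> test_functions_partial[OF test_functions_component[OF \<psi>]]])
  finally show "inner (abs_L2 (classical_grad \<phi>)) (abs_L2 \<psi>) = - inner (abs_L2 \<phi>) (abs_L2 (classical_div \<psi>))"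
    by (simp add: inner_abs_L2_real[OF \<phi> test_functions_div[OF \<psi>]])
qed (use \<phi> in \<open>auto intro: abs_L2_test_in_L2_on test_functions_grad\<close>)

text \<open>The sign from integration by parts is absorbed by the antisymmetry of the curl, which is
  why its weak form carries no minus.\<close>

lemma has_weak_curl_test:
  assumes \<phi>: "\<phi> \<in> test_functions \<Omega>"
  shows "has_weak_curl \<Omega> (abs_L2 \<phi>) (abs_L2 (classical_curl \<phi>))"
  unfolding has_weak_curl_def
proof (intro conjI ballI)
  fix \<psi> :: "real^3 \<Rightarrow> real^3" assume \<psi>: "\<psi> \<in> test_functions \<Omega>"
  note int = integrable_mult_test[OF test_functions_partial[OF test_functions_component[OF \<phi>]] test_functions_component[OF \<psi>]]
    integrable_mult_test[OF test_functions_component[OF \<phi>] test_functions_partial[OF test_functions_component[OF \<psi>]]]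
  have bp: "(LINT x|lborel. partial i (\<lambda>x. \<phi> x $ k) x * \<psi> x $ l) =
      - (LINT x|lborel. \<phi> x $ k * partial i (\<lambda>x. \<psi> x $ l) x)" for i k l
    by (rule integration_by_parts_test[OF test_functions_component[OF \<phi>] test_functions_component[OF \<psi>]])
  show "inner (abs_L2 (classical_curl \<phi>)) (abs_L2 \<psi>) = inner (abs_L2 \<phi>) (abs_L2 (classical_curl \<psi>))"
    unfolding inner_abs_L2_vec[OF test_functions_curl[OF \<phi>] \<psi>] inner_abs_L2_vec[OF \<phi> test_functions_curl[OF \<psi>]]
      sum_3 classical_curl_components[OF \<phi>] classical_curl_components[OF \<psi>]
    by (simp add: left_diff_distrib right_diff_distrib int bp)
qed (use \<phi> in \<open>auto intro: abs_L2_test_in_L2_on test_functions_curl\<close>)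

text \<open>The six terms cancel in pairs by symmetry of the mixed integrals. Read one way this is
  the weak form of curl grad = 0, read the other way that of div curl = 0; both complex properties
  are drawn from it.\<close>

lemma inner_grad_curl_test:
  assumes f: "f \<in> test_functions \<Omega>" and F: "F \<in> test_functions \<Omega>'"
  shows "inner (abs_L2 (classical_grad f)) (abs_L2 (classical_curl F)) = 0"
proof -
  note int = integrable_mult_test[OF test_functions_partial[OF f] test_functions_partial[OF test_functions_component[OF F]]]
  note comm = integral_partial_partial_commute[OF f test_functions_component[OF F]]
  show ?thesis
    unfolding inner_abs_L2_vec[OF test_functions_grad[OF f] test_functions_curl[OF F]]
      sum_3 classical_curl_components[OF F]
    using comm[of 1 2 3] comm[of 1 3 2] comm[of 2 3 1]
    by (simp add: right_diff_distrib int classical_grad_def)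
qed

text \<open>Two weak gradients differ by an element of \<open>L2_on \<Omega>\<close> that is
  orthogonal to all test functions, hence by zero; the description in \<open>grad\<close> then
  selects the given one.\<close>

lemma grad_eqI:
  assumes "open \<Omega>" and g: "has_weak_grad \<Omega> u g"
  shows "grad \<Omega> u = g"
  unfolding grad_def
proof (rule the_equality, rule g)
  fix g' assume g': "has_weak_grad \<Omega> u g'"
  have "g' - g = 0"
    using g g' subspace_diff[OF subspace_L2_on]
    by (intro L2_eq_0_if_orthogonal_test_functions[OF \<open>open \<Omega>\<close>]) (auto simp: has_weak_grad_def inner_diff_left)
  then show "g' = g" by simp
qed

lemma curl_eqI:
  assumes "open \<Omega>" and g: "has_weak_curl \<Omega> u g"
  shows "curl \<Omega> u = g"
  unfolding curl_def
proof (rule the_equality, rule g)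
  fix g' assume g': "has_weak_curl \<Omega> u g'"
  have "g' - g = 0"
    using g g' subspace_diff[OF subspace_L2_on]
    by (intro L2_eq_0_if_orthogonal_test_functions[OF \<open>open \<Omega>\<close>]) (auto simp: has_weak_curl_def inner_diff_left)
  then show "g' = g" by simp
qed

lemma divergence_eqI:
  assumes "open \<Omega>" and g: "has_weak_div \<Omega> u g"
  shows "divergence \<Omega> u = g"
  unfolding divergence_def
proof (rule the_equality, rule g)
  fix g' assume g': "has_weak_div \<Omega> u g'"
  have "g' - g = 0"
    using g g' subspace_diff[OF subspace_L2_on]
    by (intro L2_eq_0_if_orthogonal_test_functions[OF \<open>open \<Omega>\<close>]) (auto simp: has_weak_div_def inner_diff_left)
  then show "g' = g" by simp
qed

lemma has_weak_grad_grad: "open \<Omega> \<Longrightarrow> u \<in> H1 \<Omega> \<Longrightarrow> has_weak_grad \<Omega> u (grad \<Omega> u)"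
  by (auto simp: H1_def grad_eqI)

lemma has_weak_curl_curl: "open \<Omega> \<Longrightarrow> u \<in> Hcurl \<Omega> \<Longrightarrow> has_weak_curl \<Omega> u (curl \<Omega> u)"
  by (auto simp: Hcurl_def curl_eqI)

lemma linear_on_subspace_grad:
  assumes "open \<Omega>" "V \<subseteq> H1 \<Omega>"
  shows "linear_on_subspace V (grad \<Omega>)"
  unfolding linear_on_subspace_def
proof (intro conjI ballI allI)
  fix x y assume "x \<in> V" "y \<in> V"
  then have "x \<in> H1 \<Omega>" "y \<in> H1 \<Omega>" using assms(2) by auto
  then show "grad \<Omega> (x + y) = grad \<Omega> x + grad \<Omega> y"
    using has_weak_grad_grad[OF assms(1), of x] has_weak_grad_grad[OF assms(1), of y]
    by (intro grad_eqI[OF assms(1)]) (auto simp: has_weak_grad_def L2_on_add inner_add_left)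
next
  fix c x assume "x \<in> V"
  then have "x \<in> H1 \<Omega>" using assms(2) by auto
  then show "grad \<Omega> (c *\<^sub>R x) = c *\<^sub>R grad \<Omega> x"
    using has_weak_grad_grad[OF assms(1), of x]
    by (intro grad_eqI[OF assms(1)]) (auto simp: has_weak_grad_def L2_on_scaleR)
qed

lemma linear_on_subspace_curl:
  assumes "open \<Omega>" "V \<subseteq> Hcurl \<Omega>"
  shows "linear_on_subspace V (curl \<Omega>)"
  unfolding linear_on_subspace_def
proof (intro conjI ballI allI)
  fix x y assume "x \<in> V" "y \<in> V"
  then have "x \<in> Hcurl \<Omega>" "y \<in> Hcurl \<Omega>" using assms(2) by auto
  then show "curl \<Omega> (x + y) = curl \<Omega> x + curl \<Omega> y"
    using has_weak_curl_curl[OF assms(1), of x] has_weak_curl_curl[OF assms(1), of y]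
    by (intro curl_eqI[OF assms(1)]) (auto simp: has_weak_curl_def L2_on_add inner_add_left)
next
  fix c x assume "x \<in> V"
  then have "x \<in> Hcurl \<Omega>" using assms(2) by auto
  then show "curl \<Omega> (c *\<^sub>R x) = c *\<^sub>R curl \<Omega> x"
    using has_weak_curl_curl[OF assms(1), of x]
    by (intro curl_eqI[OF assms(1)]) (auto simp: has_weak_curl_def L2_on_scaleR)
qed

text \<open>\<open>H1_0\<close> speaks of weak gradients of classes. Choosing test functions as
  representatives turns them into classical gradients, to which the integral identities
  apply.\<close>

lemma H1_0_approximation:
  assumes "open \<Omega>" "u \<in> H1_0 \<Omega>"
  obtains \<Phi> where "\<And>n. \<Phi> n \<in> test_functions \<Omega>" "(\<lambda>n. abs_L2 (\<Phi> n)) \<longlonglongrightarrow> u"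
    "(\<lambda>n. abs_L2 (classical_grad (\<Phi> n))) \<longlonglongrightarrow> grad \<Omega> u"
proof -
  obtain \<phi> where \<phi>: "\<And>n. \<phi> n \<in> abs_L2 ` test_functions \<Omega>" "\<phi> \<longlonglongrightarrow> u"
    "(\<lambda>n. grad \<Omega> (\<phi> n)) \<longlonglongrightarrow> grad \<Omega> u"
    using assms(2) by (auto simp: H1_0_def)
  have "\<forall>n. \<exists>f. f \<in> test_functions \<Omega> \<and> \<phi> n = abs_L2 f" using \<phi>(1) by blast
  then obtain \<Phi> where \<Phi>: "\<And>n. \<Phi> n \<in> test_functions \<Omega>" "\<And>n. \<phi> n = abs_L2 (\<Phi> n)"
    by metis
  then have "grad \<Omega> (\<phi> n) = abs_L2 (classical_grad (\<Phi> n))" for n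
    using grad_eqI[OF assms(1) has_weak_grad_test] by simp
  then show ?thesis using that[of \<Phi>] \<Phi>(1) \<phi>(2,3) unfolding ext[of \<phi>, OF \<Phi>(2)] by simp
qed

lemma Hcurl_0_approximation:
  assumes "open \<Omega>" "u \<in> Hcurl_0 \<Omega>"
  obtains \<Phi> where "\<And>n. \<Phi> n \<in> test_functions \<Omega>" "(\<lambda>n. abs_L2 (\<Phi> n)) \<longlonglongrightarrow> u"
    "(\<lambda>n. abs_L2 (classical_curl (\<Phi> n))) \<longlonglongrightarrow> curl \<Omega> u"
proof -
  obtain \<phi> where \<phi>: "\<And>n. \<phi> n \<in> abs_L2 ` test_functions \<Omega>" "\<phi> \<longlonglongrightarrow> u"
    "(\<lambda>n. curl \<Omega> (\<phi> n)) \<longlonglongrightarrow> curl \<Omega> u"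
    using assms(2) by (auto simp: Hcurl_0_def)
  have "\<forall>n. \<exists>f. f \<in> test_functions \<Omega> \<and> \<phi> n = abs_L2 f" using \<phi>(1) by blast
  then obtain \<Phi> where \<Phi>: "\<And>n. \<Phi> n \<in> test_functions \<Omega>" "\<And>n. \<phi> n = abs_L2 (\<Phi> n)"
    by metis
  then have "curl \<Omega> (\<phi> n) = abs_L2 (classical_curl (\<Phi> n))" for n
    using curl_eqI[OF assms(1) has_weak_curl_test] by simp
  then show ?thesis using that[of \<Phi>] \<Phi>(1) \<phi>(2,3) unfolding ext[of \<phi>, OF \<Phi>(2)] by simp
qed

text \<open>One approximating sequence proves both claims. The classical gradients converge to
  \<open>grad \<Omega> u\<close> and are orthogonal to curls of test functions, so the limit has
  weak curl zero; being test functions with curl zero themselves, they also converge in the graph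
  norm.\<close>

lemma grad_in_Hcurl_0:
  assumes \<Omega>: "open \<Omega>" and u: "u \<in> H1_0 \<Omega>"
  shows "grad \<Omega> u \<in> Hcurl_0 \<Omega>" and "curl \<Omega> (grad \<Omega> u) = 0"
proof -
  obtain \<Phi> where \<Phi>: "\<And>n. \<Phi> n \<in> test_functions \<Omega>" "(\<lambda>n. abs_L2 (\<Phi> n)) \<longlonglongrightarrow> u"
    "(\<lambda>n. abs_L2 (classical_grad (\<Phi> n))) \<longlonglongrightarrow> grad \<Omega> u"
    using H1_0_approximation[OF assms] by blast
  have g: "grad \<Omega> u \<in> L2_on \<Omega>"
    using has_weak_grad_grad[OF \<Omega>, of u] u by (auto simp: has_weak_grad_def H1_0_def)
  have "inner (grad \<Omega> u) (abs_L2 (classical_curl \<psi>)) = 0" if "\<psi> \<in> test_functions \<Omega>" for \<psi>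
  proof -
    have "(\<lambda>n. inner (abs_L2 (classical_grad (\<Phi> n))) (abs_L2 (classical_curl \<psi>)))
        \<longlonglongrightarrow> inner (grad \<Omega> u) (abs_L2 (classical_curl \<psi>))"
      by (intro tendsto_inner \<Phi>(3) tendsto_const)
    then show ?thesis using inner_grad_curl_test[OF \<Phi>(1) that] by (simp add: LIMSEQ_const_iff)
  qed
  then have w: "has_weak_curl \<Omega> (grad \<Omega> u) 0"
    using g by (simp add: has_weak_curl_def L2_on_zero)
  then show c: "curl \<Omega> (grad \<Omega> u) = 0" by (rule curl_eqI[OF \<Omega>])
  have "curl \<Omega> (abs_L2 (classical_grad (\<Phi> n))) = 0" for n
  proof (rule curl_eqI[OF \<Omega>])
    show "has_weak_curl \<Omega> (abs_L2 (classical_grad (\<Phi> n))) 0"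
      using inner_grad_curl_test[OF \<Phi>(1)]
      by (simp add: has_weak_curl_def L2_on_zero abs_L2_test_in_L2_on test_functions_grad \<Phi>(1))
  qed
  then show "grad \<Omega> u \<in> Hcurl_0 \<Omega>"
    using w \<Phi>(3) test_functions_grad[OF \<Phi>(1)]
    by (auto simp: Hcurl_0_def Hcurl_def c intro!: exI[of _ "\<lambda>n. abs_L2 (classical_grad (\<Phi> n))"])
qed

text \<open>The same orthogonality with the limit taken on the curl side: the curls of the
  approximants are divergence-free test functions.\<close>

lemma curl_in_Hdiv_0:
  assumes \<Omega>: "open \<Omega>" and u: "u \<in> Hcurl_0 \<Omega>"
  shows "curl \<Omega> u \<in> Hdiv_0 \<Omega>"
proof -
  obtain \<Phi> where \<Phi>: "\<And>n. \<Phi> n \<in> test_functions \<Omega>" "(\<lambda>n. abs_L2 (\<Phi> n)) \<longlonglongrightarrow> u"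
    "(\<lambda>n. abs_L2 (classical_curl (\<Phi> n))) \<longlonglongrightarrow> curl \<Omega> u"
    using Hcurl_0_approximation[OF assms] by blast
  have g: "curl \<Omega> u \<in> L2_on \<Omega>"
    using has_weak_curl_curl[OF \<Omega>, of u] u by (auto simp: has_weak_curl_def Hcurl_0_def)
  have orth: "inner (abs_L2 (classical_curl (\<Phi> n))) (abs_L2 (classical_grad \<psi>)) = 0"
    if "\<psi> \<in> test_functions \<Omega>" for \<psi> n
    using inner_grad_curl_test[OF that \<Phi>(1)] by (simp add: inner_commute)
  have "inner (curl \<Omega> u) (abs_L2 (classical_grad \<psi>)) = 0" if "\<psi> \<in> test_functions \<Omega>" for \<psi>
  proof -
    have "(\<lambda>n. inner (abs_L2 (classical_curl (\<Phi> n))) (abs_L2 (classical_grad \<psi>)))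
        \<longlonglongrightarrow> inner (curl \<Omega> u) (abs_L2 (classical_grad \<psi>))"
      by (intro tendsto_inner \<Phi>(3) tendsto_const)
    then show ?thesis using orth[OF that] by (simp add: LIMSEQ_const_iff)
  qed
  then have w: "has_weak_div \<Omega> (curl \<Omega> u) 0"
    using g by (simp add: has_weak_div_def L2_on_zero)
  then have c: "divergence \<Omega> (curl \<Omega> u) = 0" by (rule divergence_eqI[OF \<Omega>])
  have "divergence \<Omega> (abs_L2 (classical_curl (\<Phi> n))) = 0" for n
  proof (rule divergence_eqI[OF \<Omega>])
    show "has_weak_div \<Omega> (abs_L2 (classical_curl (\<Phi> n))) 0"
      using orth
      by (simp add: has_weak_div_def L2_on_zero abs_L2_test_in_L2_on test_functions_curl \<Phi>(1))
  qed
  then show ?thesis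
    using w \<Phi>(3) test_functions_curl[OF \<Phi>(1)]
    by (auto simp: Hdiv_0_def Hdiv_def c intro!: exI[of _ "\<lambda>n. abs_L2 (classical_curl (\<Phi> n))"])
qed

section \<open>Injectivity of the gradient\<close>

text \<open>Integrating $\varphi^2$ against the derivative of the bounded function $\arctan x_1$ gives a
  weighted Poincare inequality that holds on every open set, bounded or not.\<close>

lemma weighted_Poincare:
  assumes \<phi>: "\<phi> \<in> test_functions \<Omega>"
  shows "(LINT x|lborel. (\<phi> x)\<^sup>2 * inverse (1 + (x $ 1)\<^sup>2)) \<le>
    pi * norm (abs_L2 \<phi>) * norm (abs_L2 (classical_grad \<phi>))"
proof -
  let ?w = "\<lambda>x::real^3. arctan (x $ 1)"
  \<comment> \<open>The factor left beside \<open>\<phi>\<close> when the derivative is moved from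
    the arctangent onto the square of \<open>\<phi>\<close>.\<close>
  let ?g = "\<lambda>x. - (2 * ?w x) * partial 1 \<phi> x"
  note \<phi>D = test_functionsD[OF \<phi>]
  obtain K where K: "compact K" "\<And>x. x \<notin> K \<Longrightarrow> \<phi> x = 0" using \<phi> by (auto simp: test_functions_iff)
  have K': "partial 1 \<phi> x = 0" if "x \<notin> K" for x
    using partial_eq_0_outside_closed[OF compact_imp_closed[OF K(1)] K(2) that] by simp
  have w: "(?w has_derivative (\<lambda>h. h $ 1 * inverse (1 + (x $ 1)\<^sup>2))) (at x)" for x :: "real^3"
    using DERIV_compose_FDERIV[where f = arctan and g = "\<lambda>x. x $ 1",
        OF DERIV_arctan bounded_linear_imp_has_derivative[OF bounded_linear_vec_nth]] .
  have pw: "partial 1 ?w = (\<lambda>x. inverse (1 + (x $ 1)\<^sup>2))"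
    by (rule ext, subst partial_eqI[OF w]) (simp add: axis_def)
  have nz: "1 + (x $ 1)\<^sup>2 \<noteq> 0" for x :: "real^3"
    using zero_le_power2[of "x $ 1"] by linarith
  have cw: "continuous_on UNIV (\<lambda>x::real^3. inverse (1 + (x $ 1)\<^sup>2))"
    using nz by (intro continuous_intros) auto
  have psq: "partial 1 (\<lambda>x. \<phi> x * \<phi> x) = (\<lambda>x. 2 * \<phi> x * partial 1 \<phi> x)"
    by (rule ext) (simp add: partial_mult \<phi>D(2))
  have "(LINT x|lborel. partial 1 (\<lambda>x. \<phi> x * \<phi> x) x * ?w x) = - (LINT x|lborel. \<phi> x * \<phi> x * partial 1 ?w x)"
  proof (rule integration_by_parts[OF _ _ _ _ K(1)])
    show "(\<lambda>x. \<phi> x * \<phi> x) differentiable at x" for x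
      by (intro derivative_intros \<phi>D(2))
    show "?w differentiable at x" for x using w by (auto simp: differentiable_def)
    show "continuous_on UNIV (partial 1 (\<lambda>x. \<phi> x * \<phi> x))"
      unfolding psq by (intro continuous_intros \<phi>D(3,4))
    show "continuous_on UNIV (partial 1 ?w)" unfolding pw by (rule cw)
  qed (simp add: K(2))
  then have eq: "(LINT x|lborel. (\<phi> x)\<^sup>2 * inverse (1 + (x $ 1)\<^sup>2)) = (LINT x|lborel. \<phi> x * ?g x)"
    by (simp add: psq pw power2_eq_square mult_ac)
  have g: "square_integrable ?g"
    by (rule square_integrable_compact_support[OF _ K(1)])
      (auto simp: K' intro!: continuous_intros \<phi>D(4))
  have G: "classical_grad \<phi> \<in> test_functions \<Omega>" by (rule test_functions_grad[OF \<phi>])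
  have "norm (abs_L2 ?g) \<le> pi * norm (abs_L2 (classical_grad \<phi>))"
  proof (rule power2_le_imp_le)
    have "(norm (abs_L2 ?g))\<^sup>2 = (LINT x|lborel. ?g x * ?g x)"
      using inner_abs_L2[OF g g] by (simp add: power2_norm_eq_inner)
    also have "\<dots> \<le> (LINT x|lborel. pi\<^sup>2 * (classical_grad \<phi> x \<bullet> classical_grad \<phi> x))"
    proof (rule integral_mono)
      show "integrable lborel (\<lambda>x. ?g x * ?g x)"
        by (rule integrable_mult_square_integrable[OF g g])
      show "integrable lborel (\<lambda>x. pi\<^sup>2 * (classical_grad \<phi> x \<bullet> classical_grad \<phi> x))"
        using square_integrable_test_function[OF G]
        by (intro integrable_mult_right integrable_inner_square_integrable)
      fix x :: "real^3"
      \<comment> \<open>Origin of the constant \<open>pi\<close>: the arctangent is bounded by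
        \<open>pi / 2\<close>, and differentiating the square contributes the factor 2.\<close>
      have "\<bar>2 * ?w x\<bar> \<le> pi" using arctan_bounded[of "x $ 1"] by (auto simp: abs_le_iff)
      then have "(2 * ?w x)\<^sup>2 \<le> pi\<^sup>2"
        using power_mono[of "\<bar>2 * ?w x\<bar>" pi 2] by simp
      moreover have "(partial 1 \<phi> x)\<^sup>2 \<le> classical_grad \<phi> x \<bullet> classical_grad \<phi> x"
        by (simp add: inner_vec_def sum_3 classical_grad_def power2_eq_square)
      ultimately have "(2 * ?w x)\<^sup>2 * (partial 1 \<phi> x)\<^sup>2 \<le> pi\<^sup>2 * (classical_grad \<phi> x \<bullet> classical_grad \<phi> x)"
        by (intro mult_mono) auto
      then show "?g x * ?g x \<le> pi\<^sup>2 * (classical_grad \<phi> x \<bullet> classical_grad \<phi> x)"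
        by (simp add: power2_eq_square mult_ac)
    qed
    also have "\<dots> = (pi * norm (abs_L2 (classical_grad \<phi>)))\<^sup>2"
      using square_integrable_test_function[OF G]
      by (simp add: power_mult_distrib power2_norm_eq_inner inner_abs_L2)
    finally show "(norm (abs_L2 ?g))\<^sup>2 \<le> (pi * norm (abs_L2 (classical_grad \<phi>)))\<^sup>2" .
  qed simp
  then have "norm (abs_L2 \<phi>) * norm (abs_L2 ?g) \<le> norm (abs_L2 \<phi>) * (pi * norm (abs_L2 (classical_grad \<phi>)))"
    by (rule mult_left_mono) simp
  moreover have "(LINT x|lborel. \<phi> x * ?g x) \<le> norm (abs_L2 \<phi>) * norm (abs_L2 ?g)"
    using inner_abs_L2[OF square_integrable_test_function[OF \<phi>] g]
      norm_cauchy_schwarz[of "abs_L2 \<phi>" "abs_L2 ?g"] by simp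
  ultimately show ?thesis unfolding eq by (simp add: mult_ac)
qed

text \<open>Along an approximating sequence the right-hand side of the weighted inequality tends to
  \<open>pi * norm u * norm (grad \<Omega> u)\<close>, which is zero. The weighted integral of the
  square of \<open>u\<close> therefore vanishes, and a weight that is positive everywhere forces
  \<open>u = 0\<close>.\<close>

lemma H1_0_grad_eq_0_imp_eq_0:
  assumes \<Omega>: "open \<Omega>" and u: "u \<in> H1_0 \<Omega>" and zero: "grad \<Omega> u = 0"
  shows "u = 0"
proof -
  obtain \<Phi> where \<Phi>: "\<And>n. \<Phi> n \<in> test_functions \<Omega>" "(\<lambda>n. abs_L2 (\<Phi> n)) \<longlonglongrightarrow> u"
    "(\<lambda>n. abs_L2 (classical_grad (\<Phi> n))) \<longlonglongrightarrow> grad \<Omega> u"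
    using H1_0_approximation[OF \<Omega> u] by blast
  let ?\<omega> = "\<lambda>x::real^3. inverse (1 + (x $ 1)\<^sup>2)"
  have \<omega>: "0 < ?\<omega> x" "?\<omega> x \<le> 1" for x
    by (auto simp: add_pos_nonneg inverse_le_1_iff)
  have [measurable]: "(\<lambda>x::real^3. x $ 1) \<in> borel_measurable borel"
    by (intro borel_measurable_continuous_onI continuous_intros)
  have sq: "integrable lborel (\<lambda>x. (rep_L2 v x)\<^sup>2)" for v :: "real L2"
    using square_integrable_rep[of v] by (simp add: square_integrable_def)
  have int: "integrable lborel (\<lambda>x. (rep_L2 v x)\<^sup>2 * ?\<omega> x)" for v :: "real L2"
    by (rule Bochner_Integration.integrable_bound[OF sq[of v]])
      (use \<omega> in \<open>auto simp: abs_mult less_imp_le intro!: AE_I2 mult_left_le\<close>)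
  \<comment> \<open>The factors 2 come from $(a+b)^2 \<le> 2a^2 + 2b^2$ with \<open>u\<close> split
    into error and approximant. On the error the weight is replaced by its bound 1, which leaves a
    plain norm.\<close>
  have bound: "(LINT x|lborel. (rep_L2 u x)\<^sup>2 * ?\<omega> x) \<le>
      2 * (norm (u - abs_L2 (\<Phi> n)))\<^sup>2 +
      2 * (pi * norm (abs_L2 (\<Phi> n)) * norm (abs_L2 (classical_grad (\<Phi> n))))" for n
  proof -
    let ?v = "u - abs_L2 (\<Phi> n)"
    have r: "AE x in lborel. rep_L2 (abs_L2 (\<Phi> n)) x = \<Phi> n x"
      by (rule rep_abs_L2_AE[OF square_integrable_test_function[OF \<Phi>(1)]])
    have "(LINT x|lborel. (rep_L2 u x)\<^sup>2 * ?\<omega> x) \<le>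
        (LINT x|lborel. 2 * (rep_L2 ?v x)\<^sup>2 + 2 * ((rep_L2 (abs_L2 (\<Phi> n)) x)\<^sup>2 * ?\<omega> x))"
    proof (rule integral_mono_AE[OF int])
      show "integrable lborel (\<lambda>x. 2 * (rep_L2 ?v x)\<^sup>2 + 2 * ((rep_L2 (abs_L2 (\<Phi> n)) x)\<^sup>2 * ?\<omega> x))"
        by (intro Bochner_Integration.integrable_add integrable_mult_right sq int)
      have "AE x in lborel. rep_L2 u x = rep_L2 ?v x + rep_L2 (abs_L2 (\<Phi> n)) x"
        using rep_L2_add_AE[of ?v "abs_L2 (\<Phi> n)"] by simp
      then show "AE x in lborel. (rep_L2 u x)\<^sup>2 * ?\<omega> x \<le>
          2 * (rep_L2 ?v x)\<^sup>2 + 2 * ((rep_L2 (abs_L2 (\<Phi> n)) x)\<^sup>2 * ?\<omega> x)"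
      proof (eventually_elim)
        fix x assume eq: "rep_L2 u x = rep_L2 ?v x + rep_L2 (abs_L2 (\<Phi> n)) x"
        have "(rep_L2 u x)\<^sup>2 * ?\<omega> x \<le> (2 * (rep_L2 ?v x)\<^sup>2 + 2 * (rep_L2 (abs_L2 (\<Phi> n)) x)\<^sup>2) * ?\<omega> x"
          using sum_squares_bound[of "rep_L2 ?v x" "rep_L2 (abs_L2 (\<Phi> n)) x"] \<omega>(1)[of x]
          unfolding eq by (intro mult_right_mono) (auto simp: power2_sum)
        also have "\<dots> \<le> 2 * (rep_L2 ?v x)\<^sup>2 + 2 * ((rep_L2 (abs_L2 (\<Phi> n)) x)\<^sup>2 * ?\<omega> x)"
          using mult_left_mono[OF \<omega>(2)[of x], of "2 * (rep_L2 ?v x)\<^sup>2"] by (simp add: algebra_simps)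
        finally show "(rep_L2 u x)\<^sup>2 * ?\<omega> x \<le>
          2 * (rep_L2 ?v x)\<^sup>2 + 2 * ((rep_L2 (abs_L2 (\<Phi> n)) x)\<^sup>2 * ?\<omega> x)" .
      qed
    qed
    also have "\<dots> = 2 * (LINT x|lborel. (rep_L2 ?v x)\<^sup>2) +
        2 * (LINT x|lborel. (rep_L2 (abs_L2 (\<Phi> n)) x)\<^sup>2 * ?\<omega> x)"
      using sq int by simp
    also have "(LINT x|lborel. (rep_L2 ?v x)\<^sup>2) = (norm ?v)\<^sup>2"
      unfolding power2_norm_eq_inner inner_L2_rep by (simp add: power2_eq_square)
    also have "(LINT x|lborel. (rep_L2 (abs_L2 (\<Phi> n)) x)\<^sup>2 * ?\<omega> x) = (LINT x|lborel. (\<Phi> n x)\<^sup>2 * ?\<omega> x)"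
    proof (rule integral_cong_AE)
      have "\<Phi> n \<in> borel_measurable borel"
        using square_integrable_test_function[OF \<Phi>(1)] by (simp add: square_integrable_def)
      then show "(\<lambda>x. (\<Phi> n x)\<^sup>2 * ?\<omega> x) \<in> borel_measurable lborel" by measurable
      show "AE x in lborel. (rep_L2 (abs_L2 (\<Phi> n)) x)\<^sup>2 * ?\<omega> x = (\<Phi> n x)\<^sup>2 * ?\<omega> x"
        using r by eventually_elim simp
      show "(\<lambda>x. (rep_L2 (abs_L2 (\<Phi> n)) x)\<^sup>2 * ?\<omega> x) \<in> borel_measurable lborel" by measurable
    qed
    also have "\<dots> \<le> pi * norm (abs_L2 (\<Phi> n)) * norm (abs_L2 (classical_grad (\<Phi> n)))"
      by (rule weighted_Poincare[OF \<Phi>(1)])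
    finally show ?thesis by simp
  qed
  have "(\<lambda>n. 2 * (norm (u - abs_L2 (\<Phi> n)))\<^sup>2 +
      2 * (pi * norm (abs_L2 (\<Phi> n)) * norm (abs_L2 (classical_grad (\<Phi> n))))) \<longlonglongrightarrow>
      2 * (norm (u - u))\<^sup>2 + 2 * (pi * norm u * norm (grad \<Omega> u))"
    by (intro tendsto_intros \<Phi>)
  from LIMSEQ_le_const[OF this, of "LINT x|lborel. (rep_L2 u x)\<^sup>2 * ?\<omega> x"] bound
  have "(LINT x|lborel. (rep_L2 u x)\<^sup>2 * ?\<omega> x) \<le> 0"
    using zero by auto
  moreover have "0 \<le> (LINT x|lborel. (rep_L2 u x)\<^sup>2 * ?\<omega> x)"
    using \<omega> by (intro integral_nonneg_AE AE_I2 mult_nonneg_nonneg) (auto simp: less_imp_le)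
  ultimately have "(LINT x|lborel. (rep_L2 u x)\<^sup>2 * ?\<omega> x) = 0" by simp
  then have "AE x in lborel. (rep_L2 u x)\<^sup>2 * ?\<omega> x = 0"
    using \<omega> by (subst (asm) integral_nonneg_eq_0_iff_AE[OF int]) (auto simp: less_imp_le)
  with rep_L2_zero_AE[where 'a = real] have "AE x in lborel. rep_L2 u x = rep_L2 0 x"
  proof eventually_elim
    case (elim x)
    then show ?case using \<omega>(1)[of x] by simp
  qed
  then show ?thesis by (rule L2_eqI)
qed

section \<open>Broken spaces\<close>

lemma square_integrable_indicator_rep:
  fixes u :: "('b::euclidean_space) L2"
  assumes [measurable]: "S \<in> sets borel"
  shows "square_integrable (\<lambda>x. indicator S x *\<^sub>R rep_L2 u x)"
proof -
  have "integrable lborel (\<lambda>x. indicator S x *\<^sub>R (norm (rep_L2 u x))\<^sup>2)"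
    using square_integrable_rep[of u] by (intro integrable_mult_indicator) (auto simp: square_integrable_def)
  moreover have "(\<lambda>x. (norm (indicator S x *\<^sub>R rep_L2 u x))\<^sup>2) = (\<lambda>x. indicator S x *\<^sub>R (norm (rep_L2 u x))\<^sup>2)"
    by (auto simp: indicator_def)
  ultimately show ?thesis by (simp add: square_integrable_def)
qed

lemma rep_restrict_L2_AE:
  "S \<in> sets borel \<Longrightarrow> AE x in lborel. rep_L2 (restrict_L2 S u) x = indicator S x *\<^sub>R rep_L2 u x"
  unfolding restrict_L2_def by (rule rep_abs_L2_AE[OF square_integrable_indicator_rep])

lemma restrict_L2_in_L2_on: "S \<in> sets borel \<Longrightarrow> restrict_L2 S u \<in> L2_on S"
  unfolding restrict_L2_def by (rule abs_L2_in_L2_on[OF square_integrable_indicator_rep]) auto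

lemma restrict_L2_add:
  assumes "S \<in> sets borel"
  shows "restrict_L2 S (u + v) = restrict_L2 S u + restrict_L2 S v"
proof (rule L2_eqI)
  show "AE x in lborel. rep_L2 (restrict_L2 S (u + v)) x = rep_L2 (restrict_L2 S u + restrict_L2 S v) x"
    using rep_restrict_L2_AE[OF assms, of "u + v"] rep_restrict_L2_AE[OF assms, of u]
      rep_restrict_L2_AE[OF assms, of v] rep_L2_add_AE[of u v]
      rep_L2_add_AE[of "restrict_L2 S u" "restrict_L2 S v"]
    by eventually_elim (simp add: scaleR_add_right)
qed

lemma restrict_L2_scaleR:
  assumes "S \<in> sets borel"
  shows "restrict_L2 S (c *\<^sub>R u) = c *\<^sub>R restrict_L2 S u"
proof (rule L2_eqI)
  show "AE x in lborel. rep_L2 (restrict_L2 S (c *\<^sub>R u)) x = rep_L2 (c *\<^sub>R restrict_L2 S u) x"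
    using rep_restrict_L2_AE[OF assms, of "c *\<^sub>R u"] rep_restrict_L2_AE[OF assms, of u]
      rep_L2_scaleR_AE[of c u] rep_L2_scaleR_AE[of c "restrict_L2 S u"]
    by eventually_elim simp
qed

lemma inner_restrict_L2:
  assumes S: "S \<in> sets borel" and \<phi>: "\<phi> \<in> test_functions S"
  shows "inner (restrict_L2 S u) (abs_L2 \<phi>) = inner u (abs_L2 \<phi>)"
  unfolding inner_L2_abs[OF square_integrable_test_function[OF \<phi>]]
proof (rule integral_cong_AE)
  have [measurable]: "\<phi> \<in> borel_measurable borel"
    using square_integrable_test_function[OF \<phi>] by (simp add: square_integrable_def)
  show "(\<lambda>x. rep_L2 (restrict_L2 S u) x \<bullet> \<phi> x) \<in> borel_measurable lborel"
    "(\<lambda>x. rep_L2 u x \<bullet> \<phi> x) \<in> borel_measurable lborel" by measurable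
  show "AE x in lborel. rep_L2 (restrict_L2 S u) x \<bullet> \<phi> x = rep_L2 u x \<bullet> \<phi> x"
    using rep_restrict_L2_AE[OF S, of u]
  proof eventually_elim
    case (elim x)
    then show ?case using test_functionsD(5)[OF \<phi>, of x] by (cases "x \<in> S") auto
  qed
qed

lemma rep_L2_sum_AE:
  "finite I \<Longrightarrow> AE x in lborel. rep_L2 (\<Sum>i\<in>I. u i) x = (\<Sum>i\<in>I. rep_L2 (u i) x)"
proof (induction I rule: finite_induct)
  case empty
  then show ?case using rep_L2_zero_AE by simp
next
  case (insert i I)
  show ?case
    using insert.IH rep_L2_add_AE[of "u i" "\<Sum>i\<in>I. u i"]
    by eventually_elim (simp add: insert.hyps)
qed

lemma AE_lborel_notin_negligible:
  assumes "negligible N"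
  shows "AE x in lborel. x \<notin> N"
proof -
  have "AE x in lebesgue. x \<notin> N"
    using assms by (intro AE_not_in) (simp add: negligible_iff_null_sets)
  then show ?thesis by (simp add: AE_completion_iff)
qed

lemma domain_partition_measurable:
  "domain_partition \<Omega> K \<Omega>s \<Longrightarrow> k \<in> {1..K} \<Longrightarrow> \<Omega>s k \<in> sets borel"
  by (auto simp: domain_partition_def domain_def)

text \<open>Almost every point of \<open>\<Omega>\<close> lies in exactly one subdomain, because
  these are disjoint and the interfaces are null; outside \<open>\<Omega>\<close> the function
  \<open>v\<close> is zero.\<close>

lemma sum_restrict_L2:
  assumes part: "domain_partition \<Omega> K \<Omega>s" and v: "v \<in> L2_on \<Omega>"
  shows "(\<Sum>k\<in>{1..K}. restrict_L2 (\<Omega>s k) v) = v"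
proof (rule L2_eqI)
  have "AE x in lborel. \<forall>k\<in>{1..K}. rep_L2 (restrict_L2 (\<Omega>s k) v) x = indicator (\<Omega>s k) x *\<^sub>R rep_L2 v x"
    by (intro AE_ball_countable[THEN iffD2] ballI rep_restrict_L2_AE domain_partition_measurable[OF part])
      simp_all
  moreover have "AE x in lborel. x \<notin> \<Omega> - (\<Union>k\<in>{1..K}. \<Omega>s k)"
    using part by (intro AE_lborel_notin_negligible) (simp add: domain_partition_def)
  moreover have "AE x in lborel. x \<notin> \<Omega> \<longrightarrow> rep_L2 v x = 0"
    using v by (simp add: L2_on_def)
  moreover have "AE x in lborel. rep_L2 (\<Sum>k\<in>{1..K}. restrict_L2 (\<Omega>s k) v) x =
      (\<Sum>k\<in>{1..K}. rep_L2 (restrict_L2 (\<Omega>s k) v) x)"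
    by (rule rep_L2_sum_AE) simp
  ultimately show "AE x in lborel. rep_L2 (\<Sum>k\<in>{1..K}. restrict_L2 (\<Omega>s k) v) x = rep_L2 v x"
  proof eventually_elim
    case (elim x)
    have "rep_L2 (\<Sum>k\<in>{1..K}. restrict_L2 (\<Omega>s k) v) x = (\<Sum>k\<in>{1..K}. indicator (\<Omega>s k) x) *\<^sub>R rep_L2 v x"
      using elim(1,4) by (simp add: scaleR_sum_left)
    also have "(\<Sum>k\<in>{1..K}. indicator (\<Omega>s k) x :: real) = indicator (\<Union>k\<in>{1..K}. \<Omega>s k) x"
      using part by (intro indicator_UN_disjoint[symmetric]) (auto simp: domain_partition_def)
    finally show ?case using elim(2,3) by (cases "x \<in> (\<Union>k\<in>{1..K}. \<Omega>s k)") auto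
  qed
qed

text \<open>Each element is the sum of its restrictions, hence lies in the span of the union of the
  local generating sets.\<close>

lemma finite_dim_broken_space:
  assumes part: "domain_partition \<Omega> K \<Omega>s"
    and V: "\<And>k. k \<in> {1..K} \<Longrightarrow> finite_dim_subspace (V k)"
  shows "finite_dim_subspace (broken_space \<Omega> K \<Omega>s V)"
proof -
  have "\<forall>k\<in>{1..K}. \<exists>B. finite B \<and> V k = span B"
    using V by (auto simp: finite_dim_subspace_def)
  then obtain B where B: "\<And>k. k \<in> {1..K} \<Longrightarrow> finite (B k)" "\<And>k. k \<in> {1..K} \<Longrightarrow> V k = span (B k)"
    by metis
  define C where "C = (\<Union>k\<in>{1..K}. B k)"
  have "finite C" using B(1) by (simp add: C_def)
  then have C: "finite_dim_subspace (span C)" by (auto simp: finite_dim_subspace_def)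
  have sub: "subspace (V k)" if "k \<in> {1..K}" for k
    using V[OF that] by (rule finite_dim_subspace_imp_subspace)
  have zero: "restrict_L2 (\<Omega>s k) 0 = 0" if "k \<in> {1..K}" for k
    using restrict_L2_scaleR[OF domain_partition_measurable[OF part that], of 0] by simp
  have "subspace (broken_space \<Omega> K \<Omega>s V)"
    unfolding subspace_def broken_space_def
    by (auto simp: L2_on_zero L2_on_add L2_on_scaleR zero restrict_L2_add restrict_L2_scaleR
        domain_partition_measurable[OF part] subspace_0[OF sub] subspace_add[OF sub] subspace_scale[OF sub]
        simp del: atLeastAtMost_iff)
  moreover have "broken_space \<Omega> K \<Omega>s V \<subseteq> span C"
  proof
    fix v assume v: "v \<in> broken_space \<Omega> K \<Omega>s V"
    have "restrict_L2 (\<Omega>s k) v \<in> span C" if "k \<in> {1..K}" for k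
    proof -
      have "restrict_L2 (\<Omega>s k) v \<in> span (B k)" using v that unfolding broken_space_def B(2)[OF that, symmetric] by blast
      moreover have "B k \<subseteq> C" using that by (auto simp: C_def)
      ultimately show ?thesis using span_mono by blast
    qed
    then have "(\<Sum>k\<in>{1..K}. restrict_L2 (\<Omega>s k) v) \<in> span C" by (rule span_sum)
    then show "v \<in> span C" using sum_restrict_L2[OF part, of v] v by (simp add: broken_space_def)
  qed
  ultimately show ?thesis by (rule finite_dim_subspace_subset[OF C])
qed

text \<open>Test functions on \<open>S\<close> are test functions on \<open>\<Omega>\<close>, and
  pairings with them do not see values outside \<open>S\<close>; the global weak identity thus
  contains the local one.\<close>

lemma has_weak_grad_restrict:
  assumes "has_weak_grad \<Omega> u g" "S \<subseteq> \<Omega>" "S \<in> sets borel"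
  shows "has_weak_grad S (restrict_L2 S u) (restrict_L2 S g)"
  using assms test_functions_mono[OF assms(2)]
  by (auto simp: has_weak_grad_def restrict_L2_in_L2_on inner_restrict_L2 test_functions_div)

lemma has_weak_curl_restrict:
  assumes "has_weak_curl \<Omega> u g" "S \<subseteq> \<Omega>" "S \<in> sets borel"
  shows "has_weak_curl S (restrict_L2 S u) (restrict_L2 S g)"
  using assms test_functions_mono[OF assms(2)]
  by (auto simp: has_weak_curl_def restrict_L2_in_L2_on inner_restrict_L2 test_functions_curl)

text \<open>A global weak gradient restricts to the weak gradient on each subdomain, where the local
  inclusion applies. Membership in \<open>H1 \<Omega>\<close> is what rules out jumps across
  interfaces.\<close>

lemma grad_in_broken_space:
  assumes part: "domain_partition \<Omega> K \<Omega>s" and "open \<Omega>"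
    and V: "\<And>k. k \<in> {1..K} \<Longrightarrow> grad (\<Omega>s k) ` V0 k \<subseteq> V1 k"
    and q: "q \<in> broken_space \<Omega> K \<Omega>s V0" "q \<in> H1 \<Omega>"
  shows "grad \<Omega> q \<in> broken_space \<Omega> K \<Omega>s V1"
proof -
  have w: "has_weak_grad \<Omega> q (grad \<Omega> q)" using has_weak_grad_grad[OF \<open>open \<Omega>\<close> q(2)] .
  have "restrict_L2 (\<Omega>s k) (grad \<Omega> q) \<in> V1 k" if k: "k \<in> {1..K}" for k
  proof -
    have S: "open (\<Omega>s k)" "\<Omega>s k \<subseteq> \<Omega>" using part k by (auto simp: domain_partition_def domain_def)
    have "grad (\<Omega>s k) (restrict_L2 (\<Omega>s k) q) = restrict_L2 (\<Omega>s k) (grad \<Omega> q)"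
      using S by (intro grad_eqI has_weak_grad_restrict[OF w]) auto
    moreover have "restrict_L2 (\<Omega>s k) q \<in> V0 k" using q(1) k by (simp add: broken_space_def)
    ultimately show ?thesis using V[OF k] by (metis image_subset_iff)
  qed
  then show ?thesis using w by (auto simp: broken_space_def has_weak_grad_def)
qed

lemma curl_in_broken_space:
  assumes part: "domain_partition \<Omega> K \<Omega>s" and "open \<Omega>"
    and V: "\<And>k. k \<in> {1..K} \<Longrightarrow> curl (\<Omega>s k) ` V1 k \<subseteq> V2 k"
    and v: "v \<in> broken_space \<Omega> K \<Omega>s V1" "v \<in> Hcurl \<Omega>"
  shows "curl \<Omega> v \<in> broken_space \<Omega> K \<Omega>s V2"
proof -
  have w: "has_weak_curl \<Omega> v (curl \<Omega> v)" using has_weak_curl_curl[OF \<open>open \<Omega>\<close> v(2)] .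
  have "restrict_L2 (\<Omega>s k) (curl \<Omega> v) \<in> V2 k" if k: "k \<in> {1..K}" for k
  proof -
    have S: "open (\<Omega>s k)" "\<Omega>s k \<subseteq> \<Omega>" using part k by (auto simp: domain_partition_def domain_def)
    have "curl (\<Omega>s k) (restrict_L2 (\<Omega>s k) v) = restrict_L2 (\<Omega>s k) (curl \<Omega> v)"
      using S by (intro curl_eqI has_weak_curl_restrict[OF w]) auto
    moreover have "restrict_L2 (\<Omega>s k) v \<in> V1 k" using v(1) k by (simp add: broken_space_def)
    ultimately show ?thesis using V[OF k] by (metis image_subset_iff)
  qed
  then show ?thesis using w by (auto simp: broken_space_def has_weak_curl_def)
qed

section \<open>The discrete problem\<close>

text \<open>What the algebra sees of the function spaces: a finite-dimensional complex with
  injective gradient inside larger spaces. \<open>\<Omega>\<close> enters only through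
  \<open>grad \<Omega>\<close> and \<open>curl \<Omega>\<close>.\<close>

locale discrete_magnetostatics =
  fixes \<Omega> :: "(real^3) set"
    and V0h V0c :: "real L2 set" and V1h V1c V2h V2c :: "(real^3) L2 set"
  assumes fin: "finite_dim_subspace V0h" "finite_dim_subspace V1h" "finite_dim_subspace V2h"
      "finite_dim_subspace V0c" "finite_dim_subspace V1c"
    and sub: "V0c \<subseteq> V0h" "V1c \<subseteq> V1h" "V2c \<subseteq> V2h"
    and grad_linear: "linear_on_subspace V0c (grad \<Omega>)"
    and curl_linear: "linear_on_subspace V1c (curl \<Omega>)"
    and grad_in: "q \<in> V0c \<Longrightarrow> grad \<Omega> q \<in> V1c"
    and curl_in: "v \<in> V1c \<Longrightarrow> curl \<Omega> v \<in> V2c"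
    and curl_grad: "q \<in> V0c \<Longrightarrow> curl \<Omega> (grad \<Omega> q) = 0"
    and grad_inj: "q \<in> V0c \<Longrightarrow> grad \<Omega> q = 0 \<Longrightarrow> q = 0"
begin

definition "H = harmonic_forms \<Omega> V0c V1c"

lemma subspaces: "subspace V0h" "subspace V1h" "subspace V2h" "subspace V0c" "subspace V1c"
  using fin by (auto intro: finite_dim_subspace_imp_subspace)

lemma zeros: "0 \<in> V0h" "0 \<in> V1h" "0 \<in> V2h" "0 \<in> V0c" "0 \<in> V1c"
  using subspaces by (auto intro: subspace_0)

lemma grad_0: "grad \<Omega> 0 = 0" and curl_0: "curl \<Omega> 0 = 0"
  using linear_on_subspace_0[OF grad_linear zeros(4)] linear_on_subspace_0[OF curl_linear zeros(5)]
  by auto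

lemma H_iff: "v \<in> H \<longleftrightarrow> v \<in> V1c \<and> curl \<Omega> v = 0 \<and> (\<forall>q\<in>V0c. inner (grad \<Omega> q) v = 0)"
  by (simp add: H_def harmonic_forms_def)

lemma zero_in_H: "0 \<in> H"
  by (simp add: H_iff zeros curl_0)

text \<open>Project \<open>v\<close> onto the gradients. These are curl-free, so the remainder is
  still curl-free and orthogonal to them, hence harmonic.\<close>

lemma kernel_curl_decomposition:
  assumes "v \<in> V1c" "curl \<Omega> v = 0"
  obtains q h where "q \<in> V0c" "h \<in> H" "v = grad \<Omega> q + h"
proof -
  obtain y where y: "y \<in> grad \<Omega> ` V0c" "\<And>g. g \<in> grad \<Omega> ` V0c \<Longrightarrow> inner g (v - y) = 0"
    using orthogonal_projection_exists[OF finite_dim_subspace_image[OF fin(4) grad_linear]] by metis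
  then obtain q where q: "q \<in> V0c" "y = grad \<Omega> q" by auto
  have "curl \<Omega> (v - y) = 0"
    using linear_on_subspace_diff[OF curl_linear subspaces(5) assms(1), of y] assms(2) q
    by (simp add: grad_in curl_grad)
  then have "v - y \<in> H"
    using y q assms(1) grad_in[OF q(1)] subspaces(5) by (simp add: H_iff subspace_diff)
  then show ?thesis using that[of q "v - y"] q by simp
qed

text \<open>Orthogonality to the curl kernel is stated separately for its gradient and harmonic
  parts, as the mixed system delivers them.\<close>

definition solves :: "(real^3) L2 \<Rightarrow> (real^3) L2 \<Rightarrow> bool" where
  "solves J B \<longleftrightarrow> B \<in> V1c \<and> (\<forall>q\<in>V0c. inner (grad \<Omega> q) B = 0) \<and> (\<forall>h\<in>H. inner h B = 0) \<and>
     (\<forall>v\<in>V1c. inner (curl \<Omega> v) (curl \<Omega> B) = inner (curl \<Omega> v) J)"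

text \<open>Two orthogonal projections: \<open>J\<close> onto the range of the curl, which yields a
  field \<open>b\<close>, and then \<open>b\<close> onto the curl kernel \<open>K\<close>.
  Subtracting the latter leaves the curl unchanged and gives both orthogonality conditions, as
  gradients and harmonic forms lie in \<open>K\<close>.\<close>

lemma solves_exists: "\<exists>B. solves J B"
proof -
  obtain y where y: "y \<in> curl \<Omega> ` V1c" "\<And>g. g \<in> curl \<Omega> ` V1c \<Longrightarrow> inner g (J - y) = 0"
    using orthogonal_projection_exists[OF finite_dim_subspace_image[OF fin(5) curl_linear]] by metis
  then obtain b where b: "b \<in> V1c" "y = curl \<Omega> b" by auto
  define K where "K = {v \<in> V1c. curl \<Omega> v = 0}"
  have "subspace K"
    unfolding K_def using subspaces(5) linear_on_subspaceD[OF curl_linear] curl_0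
    by (auto simp: subspace_def)
  then have "finite_dim_subspace K"
    using finite_dim_subspace_subset[OF fin(5)] by (auto simp: K_def)
  then obtain k where k: "k \<in> K" "\<And>v. v \<in> K \<Longrightarrow> inner v (b - k) = 0"
    using orthogonal_projection_exists by metis
  have curl: "curl \<Omega> (b - k) = curl \<Omega> b"
    using linear_on_subspace_diff[OF curl_linear subspaces(5) b(1), of k] k(1)
    by (simp add: K_def)
  have "solves J (b - k)"
    unfolding solves_def
  proof (intro conjI ballI)
    show "b - k \<in> V1c" using b k subspaces(5) by (simp add: K_def subspace_diff)
    show "inner (grad \<Omega> q) (b - k) = 0" if "q \<in> V0c" for q
      using that k(2) by (simp add: K_def grad_in curl_grad)
    show "inner h (b - k) = 0" if "h \<in> H" for h
      using that k(2) by (simp add: K_def H_iff)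
    show "inner (curl \<Omega> v) (curl \<Omega> (b - k)) = inner (curl \<Omega> v) J" if "v \<in> V1c" for v
      using y(2)[of "curl \<Omega> v"] that b curl by (simp add: inner_diff_right)
  qed
  then show ?thesis ..
qed

text \<open>Testing with the difference shows that it is curl-free, hence a gradient plus a harmonic
  form; it is orthogonal to both.\<close>

lemma solves_unique:
  assumes B: "solves J B" and B': "solves J B'"
  shows "B = B'"
proof -
  let ?d = "B - B'"
  have d: "?d \<in> V1c" using assms subspaces(5) by (simp add: solves_def subspace_diff)
  have "curl \<Omega> ?d = curl \<Omega> B - curl \<Omega> B'"
    using assms by (auto simp: solves_def intro!: linear_on_subspace_diff[OF curl_linear subspaces(5)])
  moreover have "inner (curl \<Omega> ?d) (curl \<Omega> B) = inner (curl \<Omega> ?d) (curl \<Omega> B')"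
    using d B B' by (simp add: solves_def)
  ultimately have "inner (curl \<Omega> ?d) (curl \<Omega> ?d) = 0"
    using inner_diff_right[of "curl \<Omega> ?d" "curl \<Omega> B" "curl \<Omega> B'"] by simp
  then have "curl \<Omega> ?d = 0" by simp
  then obtain q h where qh: "q \<in> V0c" "h \<in> H" "?d = grad \<Omega> q + h"
    using kernel_curl_decomposition[OF d] by metis
  have "inner (grad \<Omega> q + h) ?d = 0"
    using assms qh(1,2) by (simp add: solves_def inner_diff_right inner_add_left)
  then have "inner ?d ?d = 0"
    using qh(3) by simp
  then show ?thesis by simp
qed

text \<open>Testing with elements of the range of $I - P$ removes every term but the stabilization, which
  makes \<open>p\<close> and \<open>B\<close> conforming whatever the sign of the parameters.\<close>

lemma variational_solution_iff:
  assumes P0: "linear_projection V0h V0c P0" and P1: "linear_projection V1h V1c P1"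
    and "\<alpha>0 \<noteq> 0" "\<alpha>1 \<noteq> 0"
  shows "variational_solution \<Omega> V0h V1h H P0 P1 \<alpha>0 \<alpha>1 J p B z \<longleftrightarrow> p = 0 \<and> z = 0 \<and> solves J B"
proof
  note P0D = linear_projectionD[OF P0] and P1D = linear_projectionD[OF P1]
  assume sol: "variational_solution \<Omega> V0h V1h H P0 P1 \<alpha>0 \<alpha>1 J p B z"
  then have in_sp: "p \<in> V0h" "B \<in> V1h" "z \<in> H"
    and eq1: "\<And>q. q \<in> V0h \<Longrightarrow> \<alpha>0 * inner (q - P0 q) (p - P0 p) + inner (grad \<Omega> (P0 q)) B = 0"
    and eq2: "\<And>v. v \<in> V1h \<Longrightarrow>
        inner v (grad \<Omega> (P0 p)) + inner (curl \<Omega> (P1 v)) (curl \<Omega> (P1 B))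
        + \<alpha>1 * inner (v - P1 v) (B - P1 B) + inner v z = inner (curl \<Omega> (P1 v)) J"
    and eq3: "\<And>w. w \<in> H \<Longrightarrow> inner w B = 0"
    by (auto simp: variational_solution_def)
  have "P0 (p - P0 p) = 0"
    using linear_on_subspace_diff[OF P0D(1) subspaces(1) in_sp(1), of "P0 p"] P0D in_sp by auto
  moreover have "p - P0 p \<in> V0h" using P0D in_sp subspaces(1) by (auto intro: subspace_diff)
  ultimately have "inner (p - P0 p) (p - P0 p) = 0"
    using eq1[of "p - P0 p"] \<open>\<alpha>0 \<noteq> 0\<close> grad_0 by simp
  then have P0p: "P0 p = p" by simp
  have p_in: "p \<in> V0c" using P0D(4)[OF in_sp(1)] P0p by simp
  have gradB: "inner (grad \<Omega> q) B = 0" if "q \<in> V0c" for q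
    using eq1[of q] that P0D(5) sub by auto
  have gp: "grad \<Omega> p \<in> V1c" using p_in by (rule grad_in)
  \<comment> \<open>\<open>grad \<Omega> p\<close> is conforming, curl-free and orthogonal to
    \<open>z\<close>, so the curl, stabilization, multiplier and source terms all drop out of
    \<open>eq2\<close>.\<close>
  have "inner (grad \<Omega> p) (grad \<Omega> p) = 0"
    using eq2[of "grad \<Omega> p"] gp sub P1D(5)[OF gp] curl_grad[OF p_in] P0p in_sp(3) p_in
    by (auto simp: H_iff)
  then have gp0: "grad \<Omega> p = 0" by simp
  then have p0: "p = 0" using grad_inj p_in by blast
  have "z \<in> V1c" "curl \<Omega> z = 0" using in_sp(3) by (auto simp: H_iff)
  then have "inner z z = 0"
    using eq2[of z] sub P1D(5)[of z] P0p gp0 by auto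
  then have z0: "z = 0" by simp
  \<comment> \<open>This test comes last: \<open>B - P1 B\<close> need not be orthogonal to
    \<open>grad \<Omega> p\<close> or to \<open>z\<close>, so both must already be zero.\<close>
  have "P1 (B - P1 B) = 0"
    using linear_on_subspace_diff[OF P1D(1) subspaces(2) in_sp(2), of "P1 B"] P1D in_sp by auto
  moreover have "B - P1 B \<in> V1h" using P1D in_sp subspaces(2) by (auto intro: subspace_diff)
  ultimately have "inner (B - P1 B) (B - P1 B) = 0"
    using eq2[of "B - P1 B"] \<open>\<alpha>1 \<noteq> 0\<close> curl_0 z0 P0p gp0 by simp
  then have P1B: "P1 B = B" by simp
  have B_in: "B \<in> V1c" using P1D(4)[OF in_sp(2)] P1B by simp
  have "inner (curl \<Omega> v) (curl \<Omega> B) = inner (curl \<Omega> v) J" if "v \<in> V1c" for v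
    using eq2[of v] that sub P1D(5)[OF that] P1B P0p gp0 z0 by auto
  then show "p = 0 \<and> z = 0 \<and> solves J B"
    using p0 z0 B_in gradB eq3 by (simp add: solves_def)
next
  note P0D = linear_projectionD[OF P0] and P1D = linear_projectionD[OF P1]
  have P_0: "P0 0 = 0" "P1 0 = 0"
    using P0D(5) P1D(5) zeros by auto
  assume "p = 0 \<and> z = 0 \<and> solves J B"
  \<comment> \<open>A broken \<open>v\<close> enters the curl terms only through the conforming
    \<open>P1 v\<close>, so the equation in \<open>solves\<close> covers it; the stabilization
    disappears because \<open>P1\<close> fixes \<open>B\<close>.\<close>
  then show "variational_solution \<Omega> V0h V1h H P0 P1 \<alpha>0 \<alpha>1 J p B z"
    using P0D(4) P1D(4)[of _] P1D(5)[of B] sub zeros zero_in_H grad_0 P_0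
    by (auto simp: variational_solution_def solves_def)
qed

text \<open>Each operator equation is an identity inside a finite-dimensional space, hence
  equivalent to equality of inner products with all elements of that space. Unfolding the adjoints
  gives the variational equations.\<close>

lemma operator_solution_iff_variational:
  assumes P0: "linear_projection V0h V0c P0" and P1: "linear_projection V1h V1c P1"
    and P2: "linear_projection V2h V2c P2"
  shows "operator_solution \<Omega> V0h V1h V2h H P0 P1 P2 \<alpha>0 \<alpha>1 J p B z \<longleftrightarrow>
     variational_solution \<Omega> V0h V1h H P0 P1 \<alpha>0 \<alpha>1 J p B z"
proof (cases "p \<in> V0h \<and> B \<in> V1h \<and> z \<in> H")
  case False
  then show ?thesis by (auto simp: operator_solution_def variational_solution_def Let_def)
next
  case True
  note P0D = linear_projectionD[OF P0] and P1D = linear_projectionD[OF P1]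
    and P2D = linear_projectionD[OF P2]
  have linP: "linear_on_subspace V0h (\<lambda>q. q - P0 q)" "linear_on_subspace V1h (\<lambda>v. v - P1 v)"
    using P0D(1) P1D(1) by (auto simp: linear_on_subspace_def scaleR_diff_right)
  have lin: "linear_on_subspace V0h (\<lambda>q. - grad \<Omega> (P0 q))"
      "linear_on_subspace V1h (\<lambda>v. curl \<Omega> (P1 v))"
    using P0D(1,4) P1D(1,4) grad_linear curl_linear by (auto simp: linear_on_subspace_def)
  note S0 = adjoint_on_properties[OF fin(1) linP(1), folded stabilization_def]
    and S1 = adjoint_on_properties[OF fin(2) linP(2), folded stabilization_def]
    and D = adjoint_on_properties[OF fin(1) lin(1)]
    and C = adjoint_on_properties[OF fin(2) lin(2)]
  define X where "X = \<alpha>0 *\<^sub>R stabilization V0h P0 p - adjoint_on V0h (\<lambda>q. - grad \<Omega> (P0 q)) B"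
  have X_in: "X \<in> V0h"
    using S0(1) D(1) subspaces(1) by (simp add: X_def stabilization_def subspace_diff subspace_scale)
  have X: "inner q X = \<alpha>0 * inner (q - P0 q) (p - P0 p) + inner (grad \<Omega> (P0 q)) B" if "q \<in> V0h" for q
    using that S0(2) D(2) by (simp add: X_def stabilization_def inner_diff_right)
  have X0: "X = 0 \<longleftrightarrow> (\<forall>q\<in>V0h. \<alpha>0 * inner (q - P0 q) (p - P0 p) + inner (grad \<Omega> (P0 q)) B = 0)"
    using X X_in by (metis inner_eq_zero_iff inner_zero_right)
  define Y where "Y = grad \<Omega> (P0 p) + adjoint_on V1h (\<lambda>v. curl \<Omega> (P1 v)) (curl \<Omega> (P1 B))
     + \<alpha>1 *\<^sub>R stabilization V1h P1 B + z"
  define Z where "Z = adjoint_on V1h (\<lambda>v. curl \<Omega> (P1 v)) (dual_projection V2h P2 J)"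
  have YZ_in: "Y \<in> V1h" "Z \<in> V1h"
    using S1(1) C(1) subspaces(2) True P0D(4) grad_in sub
    by (auto simp: Y_def Z_def stabilization_def H_iff intro!: subspace_add subspace_scale)
  have Y: "inner v Y = inner v (grad \<Omega> (P0 p)) + inner (curl \<Omega> (P1 v)) (curl \<Omega> (P1 B))
        + \<alpha>1 * inner (v - P1 v) (B - P1 B) + inner v z" if "v \<in> V1h" for v
    using that S1(2) C(2) by (simp add: Y_def stabilization_def inner_add_right)
  have Z: "inner v Z = inner (curl \<Omega> (P1 v)) J" if "v \<in> V1h" for v
  proof -
    \<comment> \<open>The curl lands in \<open>V2c\<close>, where \<open>P2\<close> is the identity;
      therefore the dual projection of \<open>J\<close> may be replaced by \<open>J\<close>.\<close>
    have c: "curl \<Omega> (P1 v) \<in> V2c" using that P1D(4) curl_in by blast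
    have "inner v Z = inner (curl \<Omega> (P1 v)) (dual_projection V2h P2 J)"
      using that C(2) by (simp add: Z_def)
    also have "\<dots> = inner J (P2 (curl \<Omega> (P1 v)))"
      using c sub dual_projection_properties(2)[OF fin(3) P2D(1)] by (auto simp: inner_commute)
    also have "\<dots> = inner (curl \<Omega> (P1 v)) J"
      using P2D(5)[OF c] by (simp add: inner_commute)
    finally show ?thesis .
  qed
  have YZ: "Y = Z \<longleftrightarrow> (\<forall>v\<in>V1h. inner v (grad \<Omega> (P0 p))
        + inner (curl \<Omega> (P1 v)) (curl \<Omega> (P1 B))
        + \<alpha>1 * inner (v - P1 v) (B - P1 B) + inner v z = inner (curl \<Omega> (P1 v)) J)"
    using Y Z YZ_in inner_eq_on_subspace_imp_eq[OF subspaces(2) YZ_in] by metis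
  show ?thesis
    unfolding operator_solution_def variational_solution_def Let_def
    using True X0 YZ unfolding X_def Y_def Z_def
    by (auto simp: orthogonal_comp_def orthogonal_def)
qed

section \<open>The Hodge-Helmholtz decomposition of the solution\<close>

lemma adjoint_curl:
  shows "adjoint_on V1c (curl \<Omega>) w \<in> V1c"
    and "v \<in> V1c \<Longrightarrow> inner v (adjoint_on V1c (curl \<Omega>) w) = inner (curl \<Omega> v) w"
  using adjoint_on_properties[OF fin(5) curl_linear] by auto

lemma adjoint_curl_orthogonal_kernel:
  "v \<in> V1c \<Longrightarrow> curl \<Omega> v = 0 \<Longrightarrow> c \<in> adjoint_on V1c (curl \<Omega>) ` V2c \<Longrightarrow> inner v c = 0"
  using adjoint_curl(2) by auto

text \<open>The orthogonal complement of a kernel lies in the range of the adjoint. The functional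
  sending \<open>curl \<Omega> v\<close> to \<open>inner v B\<close> is well defined because
  \<open>B\<close> is orthogonal to the kernel, and the adjoint maps its Riesz representative
  \<open>w\<close> to \<open>B\<close>.\<close>

lemma range_adjoint_curlI:
  assumes B: "B \<in> V1c" and orth: "\<And>v. v \<in> V1c \<Longrightarrow> curl \<Omega> v = 0 \<Longrightarrow> inner v B = 0"
  shows "B \<in> adjoint_on V1c (curl \<Omega>) ` V2c"
proof -
  \<comment> \<open>\<open>s\<close> chooses arbitrary preimages and need not be linear; only the
    product with \<open>B\<close> is independent of the choice, and therefore linear.\<close>
  define s where "s y = (SOME v. v \<in> V1c \<and> curl \<Omega> v = y)" for y
  have s: "s y \<in> V1c \<and> curl \<Omega> (s y) = y" if "y \<in> curl \<Omega> ` V1c" for y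
    unfolding s_def by (rule someI_ex) (use that in auto)
  have s_inner: "inner (s (curl \<Omega> v)) B = inner v B" if v: "v \<in> V1c" for v
  proof -
    have "curl \<Omega> (s (curl \<Omega> v) - v) = 0"
      using s[of "curl \<Omega> v"] v by (simp add: linear_on_subspace_diff[OF curl_linear subspaces(5)])
    then have "inner (s (curl \<Omega> v) - v) B = 0"
      using s[of "curl \<Omega> v"] v subspaces(5) by (intro orth) (auto intro: subspace_diff)
    then show ?thesis by (simp add: inner_diff_left)
  qed
  have "linear_on_subspace (curl \<Omega> ` V1c) (\<lambda>y. inner (s y) B)"
    unfolding linear_on_subspace_def
  proof (intro conjI ballI allI; elim imageE; hypsubst)
    fix x y assume "x \<in> V1c" "y \<in> V1c"
    then show "inner (s (curl \<Omega> x + curl \<Omega> y)) B = inner (s (curl \<Omega> x)) B + inner (s (curl \<Omega> y)) B"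
      using s_inner[of "x + y"] s_inner[of x] s_inner[of y] subspaces(5)
      by (simp add: linear_on_subspaceD[OF curl_linear] inner_add_left subspace_add)
  next
    fix c x assume "x \<in> V1c"
    then show "inner (s (c *\<^sub>R curl \<Omega> x)) B = c *\<^sub>R inner (s (curl \<Omega> x)) B"
      using s_inner[of "c *\<^sub>R x"] s_inner[of x] subspaces(5)
      by (simp add: linear_on_subspaceD[OF curl_linear] subspace_scale)
  qed
  from Riesz_finite_dim[OF finite_dim_subspace_image[OF fin(5) curl_linear] this]
  obtain w where w: "w \<in> curl \<Omega> ` V1c" "\<And>v. v \<in> V1c \<Longrightarrow> inner (curl \<Omega> v) w = inner v B"
    using s_inner by auto
  have "adjoint_on V1c (curl \<Omega>) w = B"
    using w(2) by (intro adjoint_on_eqI[OF fin(5) curl_linear B]) simp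
  then show ?thesis using w(1) curl_in by blast
qed

lemma solves_in_range_adjoint_curl:
  assumes "solves J B"
  shows "B \<in> adjoint_on V1c (curl \<Omega>) ` V2c"
proof (rule range_adjoint_curlI)
  show "B \<in> V1c" using assms by (simp add: solves_def)
  show "inner v B = 0" if "v \<in> V1c" "curl \<Omega> v = 0" for v
    using kernel_curl_decomposition[OF that] assms by (metis solves_def inner_add_left add_0)
qed

text \<open>The range of the adjoint is orthogonal to the curl kernel, which contains gradients and
  harmonic forms; only the curl equation is left to ask for.\<close>

lemma solves_if_range_adjoint_curl:
  assumes Bc: "Bc \<in> adjoint_on V1c (curl \<Omega>) ` V2c"
    and J: "\<And>w. w \<in> curl \<Omega> ` V1c \<Longrightarrow> inner w (curl \<Omega> Bc) = inner w J"
  shows "solves J Bc"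
  unfolding solves_def using assms adjoint_curl(1) adjoint_curl_orthogonal_kernel[OF _ _ Bc]
  by (auto simp: grad_in curl_grad H_iff)

text \<open>Forwards, \<open>B\<close> is orthogonal to gradients and harmonic forms and the
  components are mutually orthogonal, so pairing \<open>B\<close> with \<open>Bg\<close> and
  \<open>Bh\<close> yields their squared norms. Backwards, \<open>Bc\<close> alone solves the
  reduced problem, whose solution is unique.\<close>

lemma solves_decomposition_iff:
  assumes B: "solves J B" and g: "Bg \<in> grad \<Omega> ` V0c" and h: "Bh \<in> H"
    and c: "Bc \<in> adjoint_on V1c (curl \<Omega>) ` V2c"
  shows "B = Bg + Bh + Bc \<longleftrightarrow>
    Bg = 0 \<and> Bh = 0 \<and> (\<forall>w\<in>curl \<Omega> ` V1c. inner w (curl \<Omega> Bc) = inner w J)"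
proof
  assume eq: "B = Bg + Bh + Bc"
  have gh: "inner Bg Bh = 0" using g h by (auto simp: H_iff)
  have gc: "inner Bg Bc = 0" and hc: "inner Bh Bc = 0"
    using g h by (auto intro!: adjoint_curl_orthogonal_kernel[OF _ _ c] simp: H_iff grad_in curl_grad)
  have "inner Bg B = 0" "inner Bh B = 0" using B g h by (auto simp: solves_def)
  then have "Bg = 0" "Bh = 0"
    using gh gc hc unfolding eq by (auto simp: inner_add_right inner_commute)
  then show "Bg = 0 \<and> Bh = 0 \<and> (\<forall>w\<in>curl \<Omega> ` V1c. inner w (curl \<Omega> Bc) = inner w J)"
    using B eq by (auto simp: solves_def)
next
  assume "Bg = 0 \<and> Bh = 0 \<and> (\<forall>w\<in>curl \<Omega> ` V1c. inner w (curl \<Omega> Bc) = inner w J)"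
  then show "B = Bg + Bh + Bc"
    using solves_unique[OF B solves_if_range_adjoint_curl[OF c]] by auto
qed

lemma magnetostatics:
  assumes P: "linear_projection V0h V0c P0" "linear_projection V1h V1c P1"
    "linear_projection V2h V2c P2" and \<alpha>: "\<alpha>0 \<noteq> 0" "\<alpha>1 \<noteq> 0"
  shows
    "(\<exists>!(p, B, z). variational_solution \<Omega> V0h V1h H P0 P1 \<alpha>0 \<alpha>1 J p B z) \<and>
     (\<forall>p B z. variational_solution \<Omega> V0h V1h H P0 P1 \<alpha>0 \<alpha>1 J p B z \<longleftrightarrow>
        operator_solution \<Omega> V0h V1h V2h H P0 P1 P2 \<alpha>0 \<alpha>1 J p B z) \<and>
     {q \<in> V0c. grad \<Omega> q = 0} = {0} \<and>
     (\<forall>g\<in>grad \<Omega> ` V0c. \<forall>h\<in>H. orthogonal g h) \<and>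
     (\<forall>g\<in>grad \<Omega> ` V0c. \<forall>c\<in>adjoint_on V1c (curl \<Omega>) ` V2c. orthogonal g c) \<and>
     (\<forall>h\<in>H. \<forall>c\<in>adjoint_on V1c (curl \<Omega>) ` V2c. orthogonal h c) \<and>
     (\<forall>p B z. variational_solution \<Omega> V0h V1h H P0 P1 \<alpha>0 \<alpha>1 J p B z \<longrightarrow>
        B \<in> V1c \<inter> (H + grad \<Omega> ` V0c)\<^sup>\<bottom> \<and>
        p \<in> {q \<in> V0c. grad \<Omega> q = 0} \<and>
        z = 0 \<and>
        B \<in> grad \<Omega> ` V0c + H + adjoint_on V1c (curl \<Omega>) ` V2c \<and>
        (\<forall>Bg\<in>grad \<Omega> ` V0c. \<forall>Bh\<in>H. \<forall>Bc\<in>adjoint_on V1c (curl \<Omega>) ` V2c.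
           B = Bg + Bh + Bc \<longleftrightarrow>
           Bg = 0 \<and> Bh = 0 \<and> (\<forall>w\<in>curl \<Omega> ` V1c. inner w (curl \<Omega> Bc) = inner w J)) \<and>
        (\<forall>P0' P1' P2' \<alpha>0' \<alpha>1' p' B' z'.
           linear_projection V0h V0c P0' \<and> linear_projection V1h V1c P1' \<and>
           linear_projection V2h V2c P2' \<and> \<alpha>0' \<noteq> 0 \<and> \<alpha>1' \<noteq> 0 \<and>
           (variational_solution \<Omega> V0h V1h H P0' P1' \<alpha>0' \<alpha>1' J p' B' z' \<or>
            operator_solution \<Omega> V0h V1h V2h H P0' P1' P2' \<alpha>0' \<alpha>1' J p' B' z') \<longrightarrow>
           p' = p \<and> B' = B \<and> z' = z))"
proof (intro conjI allI impI ballI)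
  note iff = variational_solution_iff[OF P(1,2) \<alpha>]
  show "\<exists>!(p, B, z). variational_solution \<Omega> V0h V1h H P0 P1 \<alpha>0 \<alpha>1 J p B z"
  proof -
    obtain B where B: "solves J B" using solves_exists by blast
    show ?thesis
      by (rule ex1I[of _ "(0, B, 0)"]) (auto simp: iff B intro: solves_unique[OF _ B])
  qed
  show "variational_solution \<Omega> V0h V1h H P0 P1 \<alpha>0 \<alpha>1 J p B z \<longleftrightarrow>
        operator_solution \<Omega> V0h V1h V2h H P0 P1 P2 \<alpha>0 \<alpha>1 J p B z" for p B z
    using operator_solution_iff_variational[OF P] by simp
  show ker: "{q \<in> V0c. grad \<Omega> q = 0} = {0}"
    using grad_inj grad_0 zeros by auto
  show "orthogonal g h" if "g \<in> grad \<Omega> ` V0c" "h \<in> H" for g h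
    using that by (auto simp: H_iff orthogonal_def)
  show "orthogonal g c" if "g \<in> grad \<Omega> ` V0c" "c \<in> adjoint_on V1c (curl \<Omega>) ` V2c" for g c
    using that(1) adjoint_curl_orthogonal_kernel[OF _ _ that(2)]
    by (auto simp: orthogonal_def grad_in curl_grad)
  show "orthogonal h c" if "h \<in> H" "c \<in> adjoint_on V1c (curl \<Omega>) ` V2c" for h c
    using that(1) adjoint_curl_orthogonal_kernel[OF _ _ that(2)]
    by (auto simp: orthogonal_def H_iff)
  fix p B z assume "variational_solution \<Omega> V0h V1h H P0 P1 \<alpha>0 \<alpha>1 J p B z"
  then have p: "p = 0" and z: "z = 0" and B: "solves J B" by (auto simp: iff)
  show "B \<in> V1c \<inter> (H + grad \<Omega> ` V0c)\<^sup>\<bottom>"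
    using B by (auto simp: orthogonal_comp_def orthogonal_def solves_def inner_add_left
        elim!: set_plus_elim)
  show "p \<in> {q \<in> V0c. grad \<Omega> q = 0}" using ker p by simp
  show "z = 0" by (fact z)
  \<comment> \<open>The whole field is its own curl component; the other two are zero.\<close>
  have "0 \<in> grad \<Omega> ` V0c" using grad_0 zeros by (metis imageI)
  then have "0 + 0 + B \<in> grad \<Omega> ` V0c + H + adjoint_on V1c (curl \<Omega>) ` V2c"
    using zero_in_H solves_in_range_adjoint_curl[OF B] by (intro set_plus_intro)
  then show "B \<in> grad \<Omega> ` V0c + H + adjoint_on V1c (curl \<Omega>) ` V2c" by simp
  show "B = Bg + Bh + Bc \<longleftrightarrow>
           Bg = 0 \<and> Bh = 0 \<and> (\<forall>w\<in>curl \<Omega> ` V1c. inner w (curl \<Omega> Bc) = inner w J)"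
    if "Bg \<in> grad \<Omega> ` V0c" "Bh \<in> H" "Bc \<in> adjoint_on V1c (curl \<Omega>) ` V2c" for Bg Bh Bc
    using solves_decomposition_iff[OF B that] .
  fix P0' P1' P2' \<alpha>0' \<alpha>1' p' B' z'
  assume "linear_projection V0h V0c P0' \<and> linear_projection V1h V1c P1' \<and>
           linear_projection V2h V2c P2' \<and> \<alpha>0' \<noteq> 0 \<and> \<alpha>1' \<noteq> 0 \<and>
           (variational_solution \<Omega> V0h V1h H P0' P1' \<alpha>0' \<alpha>1' J p' B' z' \<or>
            operator_solution \<Omega> V0h V1h V2h H P0' P1' P2' \<alpha>0' \<alpha>1' J p' B' z')"
  then have P': "linear_projection V0h V0c P0'" "linear_projection V1h V1c P1'"
      "linear_projection V2h V2c P2'" and \<alpha>': "\<alpha>0' \<noteq> 0" "\<alpha>1' \<noteq> 0"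
    and "variational_solution \<Omega> V0h V1h H P0' P1' \<alpha>0' \<alpha>1' J p' B' z' \<or>
         operator_solution \<Omega> V0h V1h V2h H P0' P1' P2' \<alpha>0' \<alpha>1' J p' B' z'"
    by blast+
  \<comment> \<open>Other projections and parameters lead to the same \<open>solves J\<close>, so
    its uniqueness identifies the solutions.\<close>
  then have "p' = 0 \<and> z' = 0 \<and> solves J B'"
    unfolding operator_solution_iff_variational[OF P'] variational_solution_iff[OF P'(1,2) \<alpha>']
    by simp
  then show "p' = p" "B' = B" "z' = z" using p z solves_unique[OF B] by auto
qed

end

theorem proposition3p5:
  fixes \<Omega> :: "(real^3) set" and K :: nat and \<Omega>s :: "nat \<Rightarrow> (real^3) set"
    and V0 :: "nat \<Rightarrow> real L2 set" and V1 V2 :: "nat \<Rightarrow> (real^3) L2 set"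
    and V0h V0c :: "real L2 set" and V1h V1c V2h V2c H :: "(real^3) L2 set"
    and P0 :: "real L2 \<Rightarrow> real L2" and P1 P2 :: "(real^3) L2 \<Rightarrow> (real^3) L2"
    and \<alpha>0 \<alpha>1 :: real and J :: "(real^3) L2"
  assumes "domain \<Omega>" and "domain_partition \<Omega> K \<Omega>s"
    and "\<And>k. k \<in> {1..K} \<Longrightarrow> local_spaces (\<Omega>s k) (V0 k) (V1 k) (V2 k)"
    and V0h: "V0h = broken_space \<Omega> K \<Omega>s V0"
    and V1h: "V1h = broken_space \<Omega> K \<Omega>s V1"
    and V2h: "V2h = broken_space \<Omega> K \<Omega>s V2"
    and V0c: "V0c = V0h \<inter> H1_0 \<Omega>"
    and V1c: "V1c = V1h \<inter> Hcurl_0 \<Omega>"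
    and V2c: "V2c = V2h \<inter> Hdiv_0 \<Omega>"
    and H: "H = harmonic_forms \<Omega> V0c V1c"
    and "linear_projection V0h V0c P0"
    and "linear_projection V1h V1c P1"
    and "linear_projection V2h V2c P2"
    and "\<alpha>0 \<noteq> 0" and "\<alpha>1 \<noteq> 0"
    and "J \<in> L2_on \<Omega>"
  shows
    "(\<exists>!(p, B, z). variational_solution \<Omega> V0h V1h H P0 P1 \<alpha>0 \<alpha>1 J p B z) \<and>
     (\<forall>p B z. variational_solution \<Omega> V0h V1h H P0 P1 \<alpha>0 \<alpha>1 J p B z \<longleftrightarrow>
        operator_solution \<Omega> V0h V1h V2h H P0 P1 P2 \<alpha>0 \<alpha>1 J p B z) \<and>
     {q \<in> V0c. grad \<Omega> q = 0} = {0} \<and>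
     (\<forall>g\<in>grad \<Omega> ` V0c. \<forall>h\<in>H. orthogonal g h) \<and>
     (\<forall>g\<in>grad \<Omega> ` V0c. \<forall>c\<in>adjoint_on V1c (curl \<Omega>) ` V2c. orthogonal g c) \<and>
     (\<forall>h\<in>H. \<forall>c\<in>adjoint_on V1c (curl \<Omega>) ` V2c. orthogonal h c) \<and>
     (\<forall>p B z. variational_solution \<Omega> V0h V1h H P0 P1 \<alpha>0 \<alpha>1 J p B z \<longrightarrow>
        B \<in> V1c \<inter> (H + grad \<Omega> ` V0c)\<^sup>\<bottom> \<and>
        p \<in> {q \<in> V0c. grad \<Omega> q = 0} \<and>
        z = 0 \<and>
        B \<in> grad \<Omega> ` V0c + H + adjoint_on V1c (curl \<Omega>) ` V2c \<and>
        (\<forall>Bg\<in>grad \<Omega> ` V0c. \<forall>Bh\<in>H. \<forall>Bc\<in>adjoint_on V1c (curl \<Omega>) ` V2c.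
           B = Bg + Bh + Bc \<longleftrightarrow>
           Bg = 0 \<and> Bh = 0 \<and> (\<forall>w\<in>curl \<Omega> ` V1c. inner w (curl \<Omega> Bc) = inner w J)) \<and>
        (\<forall>P0' P1' P2' \<alpha>0' \<alpha>1' p' B' z'.
           linear_projection V0h V0c P0' \<and> linear_projection V1h V1c P1' \<and>
           linear_projection V2h V2c P2' \<and> \<alpha>0' \<noteq> 0 \<and> \<alpha>1' \<noteq> 0 \<and>
           (variational_solution \<Omega> V0h V1h H P0' P1' \<alpha>0' \<alpha>1' J p' B' z' \<or>
            operator_solution \<Omega> V0h V1h V2h H P0' P1' P2' \<alpha>0' \<alpha>1' J p' B' z') \<longrightarrow>
           p' = p \<and> B' = B \<and> z' = z))"
proof -
  have \<Omega>: "open \<Omega>" using \<open>domain \<Omega>\<close> by (simp add: domain_def)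
  note part = \<open>domain_partition \<Omega> K \<Omega>s\<close> and local = assms(3)[unfolded local_spaces_def]
  have fin: "finite_dim_subspace V0h" "finite_dim_subspace V1h" "finite_dim_subspace V2h"
    unfolding V0h V1h V2h using local by (auto intro!: finite_dim_broken_space[OF part])
  note P0 = \<open>linear_projection V0h V0c P0\<close> and P1 = \<open>linear_projection V1h V1c P1\<close>
    and P2 = \<open>linear_projection V2h V2c P2\<close>
  have H1: "V0c \<subseteq> H1 \<Omega>" and Hcurl: "V1c \<subseteq> Hcurl \<Omega>"
    by (auto simp: V0c V1c H1_0_def Hcurl_0_def)
  \<comment> \<open>The harmonic space of the locale is rewritten to the \<open>H\<close> of the
    statement, so that the abstract result matches it literally.\<close>
  interpret discrete_magnetostatics \<Omega> V0h V0c V1h V1c V2h V2c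
    rewrites harmonic: "discrete_magnetostatics.H \<Omega> V0c V1c = H"
  proof -
    show "discrete_magnetostatics \<Omega> V0h V0c V1h V1c V2h V2c"
    proof
      show "finite_dim_subspace V0c" "finite_dim_subspace V1c"
        using finite_dim_subspace_range_projection fin P0 P1 by metis+
      show "V0c \<subseteq> V0h" "V1c \<subseteq> V1h" "V2c \<subseteq> V2h" by (auto simp: V0c V1c V2c)
      show "linear_on_subspace V0c (grad \<Omega>)" by (rule linear_on_subspace_grad[OF \<Omega> H1])
      show "linear_on_subspace V1c (curl \<Omega>)" by (rule linear_on_subspace_curl[OF \<Omega> Hcurl])
      \<comment> \<open>Conformity combines two facts: the local inclusions give membership in the
        broken space, and approximability by test functions passes from \<open>q\<close> to its
        gradient.\<close>
      show "grad \<Omega> q \<in> V1c" if "q \<in> V0c" for q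
        using that H1 grad_in_Hcurl_0(1)[OF \<Omega>, of q] local
          grad_in_broken_space[OF part \<Omega>, of V0 V1 q]
        by (auto simp: V0c V1c V0h V1h)
      show "curl \<Omega> v \<in> V2c" if "v \<in> V1c" for v
        using that Hcurl curl_in_Hdiv_0[OF \<Omega>, of v] local
          curl_in_broken_space[OF part \<Omega>, of V1 V2 v]
        by (auto simp: V1c V2c V1h V2h)
      show "curl \<Omega> (grad \<Omega> q) = 0" if "q \<in> V0c" for q
        using that grad_in_Hcurl_0(2)[OF \<Omega>] by (simp add: V0c)
      show "q = 0" if "q \<in> V0c" "grad \<Omega> q = 0" for q
        using that H1_0_grad_eq_0_imp_eq_0[OF \<Omega>] by (simp add: V0c)
    qed (fact fin)+
    then show "discrete_magnetostatics.H \<Omega> V0c V1c = H"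
      by (simp add: discrete_magnetostatics.H_def H)
  qed
  show ?thesis
    by (rule magnetostatics[OF P0 P1 P2 \<open>\<alpha>0 \<noteq> 0\<close> \<open>\<alpha>1 \<noteq> 0\<close>])
qed

end
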